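(* Let $R$ be a left Artinian ring. Then $R$ is left MacWilliams if and only if $R$ is left pseudo-injective and the finitary left socle $\mathrm{soc}^{\ast}({}_R R)$ embeds, as a left $R$-module, into ${}_R(R/\mathrm{rad}\,R)$.
   Context: Rings are unital (not necessarily commutative). $\mathrm{rad}\,R$ is the Jacobson radical of $R$. The finitary left socle $\mathrm{soc}^{\ast}({}_R R)$ is the sum of all minimal left ideals of $R$ that are finite as sets. A module embeds into another if there is an injective module homomorphism. $R$ is left pseudo-injective if for every left ideal $I$ of $R$, each injective left $R$-module homomorphism $I \to R$ is given by right multiplication by an element of $R$. The Hamming weight on $R$ is $w_{\mathrm{H}}(x)=0$ if $x=0$ and $w_{\mathrm{H}}(x)=1$ otherwise; for $x=(x_1,\dots,x_n)\in R^n$ put $w_{\mathrm{H}}(x)=\sum_{i=1}^n w_{\mathrm{H}}(x_i)$. Let $U(R)$ be the group of (two-sided) units of $R$. For $n\ge 1$, $\sigma\in S_n$ and $u\in U(R)^n$ let $\Phi_{\sigma,u}\colon {}_R R^n\to {}_R R^n$, $x\mapsto (x_{\sigma 1}u_1,\dots,x_{\sigma n}u_n)$. The ring $R$ is left MacWilliams if, for every integer $n\ge 1$ and any left $R$-module homomorphism $\phi\colon M\to N$ between submodules $M,N$ of ${}_R R^n$ with $w_{\mathrm{H}}(\phi(x))=w_{\mathrm{H}}(x)$ for all $x\in M$, there exist $\sigma\in S_n$ and $u\in U(R)^n$ such that $\phi(x)=\Phi_{\sigma,u}(x)$ for all $x\in M$. *)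

theory Defs
  imports Main "HOL-Library.Function_Algebras" "HOL-Combinatorics.Permutations"
begin

text \<open>
  A ring is a type of sort \<open>{ring, monoid_mult}\<close>: unital, not necessarily
  commutative. In contrast to \<open>ring_1\<close>, this sort admits the zero ring.
\<close>

text \<open>The analogue of the locale \<open>module\<close> of \<open>HOL.Modules\<close>, which is
  restricted to commutative scalars.\<close>

locale left_module =
  fixes scale :: "'r::{ring,monoid_mult} \<Rightarrow> 'm::ab_group_add \<Rightarrow> 'm"
  assumes scale_right_distrib: "scale r (x + y) = scale r x + scale r y"
    and scale_left_distrib: "scale (r + s) x = scale r x + scale s x"
    and scale_scale: "scale r (scale s x) = scale (r * s) x"
    and scale_one: "scale 1 x = x"

definition submodule :: "('r \<Rightarrow> 'm::ab_group_add \<Rightarrow> 'm) \<Rightarrow> 'm set \<Rightarrow> bool" where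
  "submodule scale M \<longleftrightarrow>
     0 \<in> M \<and> (\<forall>x\<in>M. \<forall>y\<in>M. x + y \<in> M) \<and> (\<forall>r. \<forall>x\<in>M. scale r x \<in> M)"

definition left_hom ::
  "('r \<Rightarrow> 'm::ab_group_add \<Rightarrow> 'm) \<Rightarrow> 'm set \<Rightarrow> ('r \<Rightarrow> 'n::ab_group_add \<Rightarrow> 'n) \<Rightarrow> 'n set
    \<Rightarrow> ('m \<Rightarrow> 'n) \<Rightarrow> bool" where
  "left_hom scale\<^sub>1 M scale\<^sub>2 N f \<longleftrightarrow>
     (\<forall>x\<in>M. f x \<in> N) \<and>
     (\<forall>x\<in>M. \<forall>y\<in>M. f (x + y) = f x + f y) \<and>
     (\<forall>r. \<forall>x\<in>M. f (scale\<^sub>1 r x) = scale\<^sub>2 r (f x))"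

definition embeds ::
  "('r \<Rightarrow> 'm::ab_group_add \<Rightarrow> 'm) \<Rightarrow> 'm set \<Rightarrow> ('r \<Rightarrow> 'n::ab_group_add \<Rightarrow> 'n) \<Rightarrow> 'n set \<Rightarrow> bool" where
  "embeds scale\<^sub>1 M scale\<^sub>2 N \<longleftrightarrow> (\<exists>f. left_hom scale\<^sub>1 M scale\<^sub>2 N f \<and> inj_on f M)"

text \<open>The sum of a (possibly infinite or empty) family of submodules.\<close>

definition sum_of_submodules :: "'m::ab_group_add set set \<Rightarrow> 'm set" where
  "sum_of_submodules \<F> = {sum f F | f F. finite F \<and> F \<subseteq> \<F> \<and> (\<forall>A\<in>F. f A \<in> A)}"

lemma left_module_mult: "left_module ((*) :: 'r::{ring,monoid_mult} \<Rightarrow> 'r \<Rightarrow> 'r)"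
  by unfold_locales (simp_all add: distrib_left distrib_right mult.assoc)

abbreviation left_ideal :: "'r::{ring,monoid_mult} set \<Rightarrow> bool" where
  "left_ideal \<equiv> submodule (*)"

definition left_artinian :: "'r::{ring,monoid_mult} itself \<Rightarrow> bool" where
  "left_artinian _ \<longleftrightarrow>
     (\<forall>I :: nat \<Rightarrow> 'r set. (\<forall>k. left_ideal (I k)) \<and> (\<forall>k. I (Suc k) \<subseteq> I k)
        \<longrightarrow> (\<exists>m. \<forall>k\<ge>m. I k = I m))"

definition minimal_left_ideal :: "'r::{ring,monoid_mult} set \<Rightarrow> bool" where
  "minimal_left_ideal I \<longleftrightarrow>
     left_ideal I \<and> I \<noteq> {0} \<and> (\<forall>K. left_ideal K \<and> K \<subseteq> I \<longrightarrow> K = {0} \<or> K = I)"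

definition maximal_left_ideal :: "'r::{ring,monoid_mult} set \<Rightarrow> bool" where
  "maximal_left_ideal I \<longleftrightarrow>
     left_ideal I \<and> I \<noteq> UNIV \<and> (\<forall>K. left_ideal K \<and> I \<subseteq> K \<longrightarrow> K = I \<or> K = UNIV)"

definition finitary_left_socle :: "'r::{ring,monoid_mult} set" where
  "finitary_left_socle = sum_of_submodules {I. minimal_left_ideal I \<and> finite I}"

definition jacobson_radical :: "'r::{ring,monoid_mult} set" where
  "jacobson_radical = \<Inter> {I. maximal_left_ideal I}"

lemma left_ideal_jacobson_radical: "left_ideal jacobson_radical"
  by (auto simp: jacobson_radical_def maximal_left_ideal_def submodule_def)

lemma jacobson_radical_zero: "0 \<in> jacobson_radical"
  and jacobson_radical_add:
    "x \<in> jacobson_radical \<Longrightarrow> y \<in> jacobson_radical \<Longrightarrow> x + y \<in> jacobson_radical"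
  and jacobson_radical_mult: "x \<in> jacobson_radical \<Longrightarrow> r * x \<in> jacobson_radical"
  using left_ideal_jacobson_radical by (auto simp: submodule_def)

lemma jacobson_radical_uminus: "x \<in> jacobson_radical \<Longrightarrow> - x \<in> jacobson_radical"
  using jacobson_radical_mult[of x "- 1"] by simp

definition rad_rel :: "'r::{ring,monoid_mult} \<Rightarrow> 'r \<Rightarrow> bool" where
  "rad_rel x y \<longleftrightarrow> x - y \<in> jacobson_radical"

lemma equivp_rad_rel: "equivp (rad_rel :: 'r::{ring,monoid_mult} \<Rightarrow> 'r \<Rightarrow> bool)"
proof (rule equivpI)
  show "reflp (rad_rel :: 'r \<Rightarrow> _)"
    by (simp add: reflp_def rad_rel_def jacobson_radical_zero)
  show "symp (rad_rel :: 'r \<Rightarrow> _)"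
    by (rule sympI) (use jacobson_radical_uminus in \<open>fastforce simp: rad_rel_def\<close>)
  show "transp (rad_rel :: 'r \<Rightarrow> _)"
  proof (rule transpI)
    fix x y z :: 'r
    assume "rad_rel x y" "rad_rel y z"
    then have "(x - y) + (y - z) \<in> jacobson_radical"
      unfolding rad_rel_def by (rule jacobson_radical_add)
    then show "rad_rel x z" by (simp add: rad_rel_def)
  qed
qed

quotient_type (overloaded) 'r rad_quot = "'r::{ring,monoid_mult}" / rad_rel
  by (rule equivp_rad_rel)

instantiation rad_quot :: ("{ring,monoid_mult}") ab_group_add
begin

lift_definition zero_rad_quot :: "'a rad_quot" is 0 .

lift_definition plus_rad_quot :: "'a rad_quot \<Rightarrow> 'a rad_quot \<Rightarrow> 'a rad_quot" is "(+)"
  unfolding rad_rel_def by (drule jacobson_radical_add, assumption) (simp add: algebra_simps)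

lift_definition uminus_rad_quot :: "'a rad_quot \<Rightarrow> 'a rad_quot" is uminus
  unfolding rad_rel_def by (drule jacobson_radical_uminus) (simp add: algebra_simps)

lift_definition minus_rad_quot :: "'a rad_quot \<Rightarrow> 'a rad_quot \<Rightarrow> 'a rad_quot" is "(-)"
  unfolding rad_rel_def
  by (drule jacobson_radical_add, erule jacobson_radical_uminus) (simp add: algebra_simps)

instance
  by standard (transfer; simp add: rad_rel_def jacobson_radical_zero algebra_simps)+

end

lift_definition rad_quot_scale :: "'r::{ring,monoid_mult} \<Rightarrow> 'r rad_quot \<Rightarrow> 'r rad_quot" is "(*)"
  unfolding rad_rel_def by (drule jacobson_radical_mult) (simp add: algebra_simps)

lemma left_module_rad_quot:
  "left_module (rad_quot_scale :: 'r::{ring,monoid_mult} \<Rightarrow> 'r rad_quot \<Rightarrow> 'r rad_quot)"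
  by unfold_locales
    (transfer; simp add: rad_rel_def jacobson_radical_zero algebra_simps)+

definition left_pseudo_injective :: "'r::{ring,monoid_mult} itself \<Rightarrow> bool" where
  "left_pseudo_injective _ \<longleftrightarrow>
     (\<forall>(I :: 'r set) f. left_ideal I \<and> left_hom (*) I (*) UNIV f \<and> inj_on f I
        \<longrightarrow> (\<exists>c. \<forall>x\<in>I. f x = x * c))"

definition ring_units :: "'r::monoid_mult set" where
  "ring_units = {u. \<exists>v. u * v = 1 \<and> v * u = 1}"

text \<open>The elements of \<open>R^n\<close> are the functions on the naturals vanishing off \<open>{..<n}\<close>;
  addition is pointwise, by \<open>HOL-Library.Function_Algebras\<close>.\<close>

definition vec_space :: "nat \<Rightarrow> (nat \<Rightarrow> 'r::zero) set" where
  "vec_space n = {x. \<forall>i\<ge>n. x i = 0}"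

definition vec_scale :: "'r::times \<Rightarrow> (nat \<Rightarrow> 'r) \<Rightarrow> nat \<Rightarrow> 'r" where
  "vec_scale r x = (\<lambda>i. r * x i)"

lemma left_module_vec_scale:
  "left_module (vec_scale :: 'r::{ring,monoid_mult} \<Rightarrow> (nat \<Rightarrow> 'r) \<Rightarrow> nat \<Rightarrow> 'r)"
  by unfold_locales (simp_all add: vec_scale_def fun_eq_iff algebra_simps)

lemma submodule_vec_space:
  "submodule vec_scale (vec_space n :: (nat \<Rightarrow> 'r::{ring,monoid_mult}) set)"
  by (auto simp: submodule_def vec_space_def vec_scale_def)

definition hamming_weight :: "nat \<Rightarrow> (nat \<Rightarrow> 'r::zero) \<Rightarrow> nat" where
  "hamming_weight n x = (\<Sum>i<n. if x i = 0 then 0 else 1)"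

definition monomial_map ::
  "nat \<Rightarrow> (nat \<Rightarrow> nat) \<Rightarrow> (nat \<Rightarrow> 'r::{ring,monoid_mult}) \<Rightarrow> (nat \<Rightarrow> 'r) \<Rightarrow> nat \<Rightarrow> 'r" where
  "monomial_map n \<sigma> u x = (\<lambda>i. if i < n then x (\<sigma> i) * u i else 0)"

definition left_MacWilliams :: "'r::{ring,monoid_mult} itself \<Rightarrow> bool" where
  "left_MacWilliams _ \<longleftrightarrow>
     (\<forall>n\<ge>1. \<forall>(M :: (nat \<Rightarrow> 'r) set) N \<phi>.
        submodule vec_scale M \<and> M \<subseteq> vec_space n \<and>
        submodule vec_scale N \<and> N \<subseteq> vec_space n \<and>
        left_hom vec_scale M vec_scale N \<phi> \<and>
        (\<forall>x\<in>M. hamming_weight n (\<phi> x) = hamming_weight n x)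
        \<longrightarrow> (\<exists>\<sigma> u. \<sigma> permutes {..<n} \<and> (\<forall>i<n. u i \<in> ring_units) \<and>
               (\<forall>x\<in>M. \<phi> x = monomial_map n \<sigma> u x)))"

end

theory Submission
  imports Defs Complex_Main "HOL-Library.Set_Algebras"
begin

text \<open>
  Left ideals have complements modulo the radical, so the finitary left socle \<open>A\<close> embeds into
  \<open>R / rad R\<close> if and only if it is a principal left ideal.

  If \<open>A\<close> is not principal, Moebius inversion over its submodules produces two codes with equal weights
  of which only one has a zero coordinate.

  If \<open>A\<close> is principal, it has a character \<open>\<chi>\<close> that is nontrivial on every nonzero left ideal inside
  \<open>A\<close>. A weight-preserving homomorphism yields a linear relation between the indicator functions of
  the kernels of the coordinates. Difference operators remove all kernels from it except a given
  minimal one, and \<open>\<chi>\<close> guides their choice so that they do not annihilate the latter; no characters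
  of infinite groups are needed. So kernels of coordinates match, and over a left Artinian left
  pseudo-injective ring two homomorphisms with the same kernel differ by a unit.
\<close>

section \<open>Left ideals and sums of minimal left ideals\<close>

text \<open>The obstacle is that the ring may be infinite, so no character of it is at hand to test
  a relation. Tested instead is a function of finite support on the ring, at first a multiple of the
  indicator of 0. A kernel to be removed is mapped onto a nonzero left ideal of the ring, and each
  element of this ideal is an admissible shift for the difference operator. An infinite left ideal
  contains a shift that separates a given finite set from the support; a finite one contains a
  finite minimal left ideal, and only there is the character consulted. This is why infinite minimal
  left ideals do not appear in the criterion.

  Units are a separate difficulty: pseudo-injectivity yields a multiplier \<open>c\<close>, but
  \<open>c\<close> need not be injective outside the given left ideal. Since every nonzero left
  ideal contains a minimal one, it is enough to alter \<open>c\<close> until it is injective on all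
  minimal left ideals. No lengths are counted for this; the room for the image of the next minimal
  left ideal comes from the descending chain condition (\<open>independent_copy\<close>).\<close>

lemma left_idealD:
  assumes "left_ideal I"
  shows "0 \<in> I" and "x \<in> I \<Longrightarrow> y \<in> I \<Longrightarrow> x + y \<in> I" and "x \<in> I \<Longrightarrow> r * x \<in> I"
    and "x \<in> I \<Longrightarrow> - x \<in> I" and "x \<in> I \<Longrightarrow> y \<in> I \<Longrightarrow> x - y \<in> I"
proof -
  show 0: "0 \<in> I" and add: "x \<in> I \<Longrightarrow> y \<in> I \<Longrightarrow> x + y \<in> I" and mult: "x \<in> I \<Longrightarrow> r * x \<in> I" for x y r
    using assms by (auto simp: submodule_def)
  show minus: "x \<in> I \<Longrightarrow> - x \<in> I" for x
    using mult[of x "- 1"] by simp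
  show "x \<in> I \<Longrightarrow> y \<in> I \<Longrightarrow> x - y \<in> I"
    using add[of x "- y"] minus[of y] by simp
qed

lemma left_ideal_zero: "left_ideal {0}"
  and left_ideal_UNIV: "left_ideal UNIV"
  and left_ideal_inter: "left_ideal I \<Longrightarrow> left_ideal K \<Longrightarrow> left_ideal (I \<inter> K)"
  and left_ideal_annihilator: "left_ideal {x. x * c = 0}"
  by (auto simp: submodule_def distrib_right mult.assoc)

lemma left_ideal_plus:
  assumes "left_ideal I" "left_ideal K"
  shows "left_ideal (I + K)"
  unfolding submodule_def
proof (intro conjI ballI allI)
  show "0 \<in> I + K"
    using assms by (auto simp: set_plus_def intro!: bexI[of _ 0] left_idealD)
next
  fix x y assume "x \<in> I + K" "y \<in> I + K"
  then obtain a b c d where "x = a + b" "y = c + d" "a \<in> I" "b \<in> K" "c \<in> I" "d \<in> K"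
    by (auto elim!: set_plus_elim)
  then have "x + y = (a + c) + (b + d)" "a + c \<in> I" "b + d \<in> K"
    using assms by (auto simp: algebra_simps left_idealD)
  then show "x + y \<in> I + K" by auto
next
  fix r x assume "x \<in> I + K"
  then obtain a b where "x = a + b" "a \<in> I" "b \<in> K" by (auto elim!: set_plus_elim)
  then have "r * x = r * a + r * b" "r * a \<in> I" "r * b \<in> K"
    using assms by (auto simp: distrib_left left_idealD)
  then show "r * x \<in> I + K" by auto
qed

section \<open>Homomorphisms of left modules\<close>

lemma (in left_module) scale_zero_left: "scale 0 x = 0"
  using scale_left_distrib[of 0 0 x] by simp

lemma (in left_module) scale_minus_one: "scale (- 1) x = - x"
  using scale_left_distrib[of "- 1" 1 x] by (simp add: scale_one scale_zero_left eq_neg_iff_add_eq_0)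

lemma (in left_module) submodule_diff:
  "submodule scale M \<Longrightarrow> x \<in> M \<Longrightarrow> y \<in> M \<Longrightarrow> x - y \<in> M"
  using scale_minus_one[of y] unfolding submodule_def by (metis add_uminus_conv_diff)

lemma left_homD:
  assumes "left_module scale\<^sub>1" "left_module scale\<^sub>2" "submodule scale\<^sub>1 M"
    and hom: "left_hom scale\<^sub>1 M scale\<^sub>2 N f"
  shows "f 0 = 0" and "x \<in> M \<Longrightarrow> y \<in> M \<Longrightarrow> f (x - y) = f x - f y"
    and "inj_on f M \<longleftrightarrow> (\<forall>x\<in>M. f x = 0 \<longrightarrow> x = 0)"
    and "submodule scale\<^sub>2 (f ` M)"
proof -
  interpret m1: left_module scale\<^sub>1 by fact
  interpret m2: left_module scale\<^sub>2 by fact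
  have M: "0 \<in> M" "\<And>x y. x \<in> M \<Longrightarrow> y \<in> M \<Longrightarrow> x + y \<in> M" "\<And>x r. x \<in> M \<Longrightarrow> scale\<^sub>1 r x \<in> M"
    using assms(3) by (auto simp: submodule_def)
  have f: "x \<in> M \<Longrightarrow> y \<in> M \<Longrightarrow> f (x + y) = f x + f y" "x \<in> M \<Longrightarrow> f (scale\<^sub>1 r x) = scale\<^sub>2 r (f x)"
    for x y r
    using hom by (auto simp: left_hom_def)
  show f0: "f 0 = 0" using f(1)[OF M(1) M(1)] by simp
  show diff: "f (x - y) = f x - f y" if "x \<in> M" "y \<in> M" for x y
    using f(1)[OF that(1) M(3)[OF that(2)], of "- 1"] f(2)[OF that(2), of "- 1"]
    by (simp add: m1.scale_minus_one m2.scale_minus_one)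
  show "inj_on f M \<longleftrightarrow> (\<forall>x\<in>M. f x = 0 \<longrightarrow> x = 0)"
  proof
    assume "inj_on f M"
    then show "\<forall>x\<in>M. f x = 0 \<longrightarrow> x = 0" using M(1) f0 by (metis inj_onD)
  next
    assume ker: "\<forall>x\<in>M. f x = 0 \<longrightarrow> x = 0"
    show "inj_on f M"
    proof (rule inj_onI)
      fix x y assume "x \<in> M" "y \<in> M" "f x = f y"
      then have "f (x - y) = 0" "x - y \<in> M" using diff m1.submodule_diff[OF assms(3)] by auto
      then have "x - y = 0" using ker by blast
      then show "x = y" by simp
    qed
  qed
  show "submodule scale\<^sub>2 (f ` M)"
    unfolding submodule_def
  proof (intro conjI ballI allI)
    show "0 \<in> f ` M" using M(1) f0 by (metis image_eqI)
    fix u v assume "u \<in> f ` M" "v \<in> f ` M"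
    then obtain x y where "u = f x" "v = f y" "x \<in> M" "y \<in> M" by blast
    then show "u + v \<in> f ` M" using M(2)[of x y] f(1) by (metis image_eqI)
  next
    fix r u assume "u \<in> f ` M"
    then obtain x where "u = f x" "x \<in> M" by blast
    then show "scale\<^sub>2 r u \<in> f ` M" using M(3)[of x r] f(2) by (metis image_eqI)
  qed
qed

lemmas ideal_homD = left_homD[OF left_module_mult left_module_mult]

lemma left_hom_mult_right: "left_hom (*) I (*) UNIV (\<lambda>x. x * (c :: 'r::{ring,monoid_mult}))"
  by (auto simp: left_hom_def distrib_right mult.assoc)

lemma left_ideal_image_mult: "left_ideal I \<Longrightarrow> left_ideal ((\<lambda>x. x * c) ` I)"
  by (rule ideal_homD(4)[OF _ left_hom_mult_right])

lemma subset_plus_left: "left_ideal K \<Longrightarrow> I \<subseteq> I + K"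
  and subset_plus_right: "left_ideal I \<Longrightarrow> K \<subseteq> I + K"
  using set_plus_intro[of _ I 0 K] set_plus_intro[of 0 I _ K] by (auto simp: left_idealD)

lemma plus_subset: "left_ideal L \<Longrightarrow> I \<subseteq> L \<Longrightarrow> K \<subseteq> L \<Longrightarrow> I + K \<subseteq> L"
  by (auto elim!: set_plus_elim simp: left_idealD subset_iff)

lemma plus_absorb: "left_ideal I \<Longrightarrow> left_ideal K \<Longrightarrow> K \<subseteq> I \<Longrightarrow> I + K = I"
  by (simp add: plus_subset subset_antisym subset_plus_left)

lemma direct_sum_cancel:
  assumes "left_ideal I" "left_ideal K" "I \<inter> K = {0}"
    and "a \<in> I" "a' \<in> I" "b \<in> K" "b' \<in> K" "a + b = a' + b'"
  shows "a = a'" "b = b'"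
proof -
  have "a - a' = b' - b" using assms(8) by (simp add: algebra_simps)
  moreover have "a - a' \<in> I" "b' - b \<in> K" using assms by (auto intro: left_idealD)
  ultimately have "a - a' \<in> I \<inter> K" by auto
  then show "a = a'" using assms(3) by auto
  then show "b = b'" using assms(8) by simp
qed

section \<open>The descending chain condition and minimal left ideals\<close>

lemma artinian_minimal:
  assumes art: "left_artinian TYPE('r::{ring,monoid_mult})"
    and P: "P (K0 :: 'r set)" and ideal: "\<And>K. P K \<Longrightarrow> left_ideal K"
  obtains K where "P K" "\<And>K'. P K' \<Longrightarrow> K' \<subseteq> K \<Longrightarrow> K' = K"
proof (rule ccontr)
  note minimal = that
  assume no_minimal: "\<not> thesis"
  have step: "\<exists>K'. P K' \<and> K' \<subset> K" if K: "P K" for K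
  proof (rule ccontr)
    assume "\<not> (\<exists>K'. P K' \<and> K' \<subset> K)"
    then have "K' = K" if "P K'" "K' \<subseteq> K" for K' using that by auto
    then show False using no_minimal minimal[of K] K by blast
  qed
  have "\<exists>F. \<forall>n. P (F n) \<and> F (Suc n) \<subset> F n"
    by (rule dependent_nat_choice) (use P step in auto)
  then obtain F where F: "\<And>n. P (F n)" "\<And>n. F (Suc n) \<subset> F n" by blast
  then have "\<exists>m. \<forall>k\<ge>m. F k = F m"
    using art[unfolded left_artinian_def, THEN spec[of _ F]] ideal by (simp add: psubset_imp_subset)
  then obtain m where "\<forall>k\<ge>m. F k = F m" ..
  then show False using F(2)[of m] by (metis le_SucI order_refl psubset_eq)
qed

lemma minimal_left_idealD:
  assumes "minimal_left_ideal S"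
  shows "left_ideal S" "S \<noteq> {0}"
    and "left_ideal K \<Longrightarrow> K \<subseteq> S \<Longrightarrow> K = {0} \<or> K = S"
    and "left_ideal K \<Longrightarrow> S \<subseteq> K \<or> S \<inter> K = {0}"
  using assms left_ideal_inter[of S K] unfolding minimal_left_ideal_def by blast+

lemma contains_minimal_left_ideal:
  assumes art: "left_artinian TYPE('r::{ring,monoid_mult})"
    and K: "left_ideal (K :: 'r set)" "K \<noteq> {0}"
  obtains S where "minimal_left_ideal S" "S \<subseteq> K"
proof -
  obtain S where S: "left_ideal S \<and> S \<noteq> {0} \<and> S \<subseteq> K"
    and min: "\<And>L. left_ideal L \<and> L \<noteq> {0} \<and> L \<subseteq> K \<Longrightarrow> L \<subseteq> S \<Longrightarrow> L = S"
    using artinian_minimal[OF art, of "\<lambda>S. left_ideal S \<and> S \<noteq> {0} \<and> S \<subseteq> K" K] K by blast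
  then have "minimal_left_ideal S"
    unfolding minimal_left_ideal_def by (meson order_trans)
  with S that show thesis by blast
qed

text \<open>Adding a summand already contained in the sum is allowed, so that closure under adding
  members is immediate; directness is recovered in \<open>finite_sum_induct\<close>.\<close>

inductive finite_sum :: "'r::{ring,monoid_mult} set set \<Rightarrow> 'r set \<Rightarrow> bool" for \<S> where
  zero: "finite_sum \<S> {0}"
| add: "finite_sum \<S> B \<Longrightarrow> S \<in> \<S> \<Longrightarrow> finite_sum \<S> (B + S)"

lemma finite_sum_left_ideal:
  assumes "finite_sum \<S> B" "\<S> \<subseteq> Collect minimal_left_ideal"
  shows "left_ideal B"
  using assms by (induction rule: finite_sum.induct) (auto intro: left_ideal_plus left_ideal_zero minimal_left_idealD(1))

text \<open>A minimal left ideal \<open>S\<close> either lies in \<open>B\<close>, where adding it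
  changes nothing, or meets \<open>B\<close> in 0. So the induction step may assume that the sum is
  direct.\<close>

lemma finite_sum_induct [consumes 2, case_names zero add]:
  assumes "finite_sum \<S> B" and min: "\<S> \<subseteq> Collect minimal_left_ideal"
    and "P {0}"
    and step: "\<And>B S. finite_sum \<S> B \<Longrightarrow> left_ideal B \<Longrightarrow> P B \<Longrightarrow> S \<in> \<S> \<Longrightarrow> left_ideal S \<Longrightarrow> B \<inter> S = {0}
      \<Longrightarrow> P (B + S)"
  shows "P B"
  using assms(1)
proof (induction rule: finite_sum.induct)
  case (add B S)
  have ideals: "left_ideal B" "left_ideal S"
    using add min finite_sum_left_ideal[OF add(1) min] minimal_left_idealD(1) by blast+
  have S: "minimal_left_ideal S" using add min by auto
  consider "S \<subseteq> B" | "B \<inter> S = {0}"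
    using minimal_left_idealD(4)[OF S ideals(1)] by blast
  then show ?case
    using plus_absorb[OF ideals] step[OF add(1) ideals(1) add(3,2) ideals(2)] add(3) by cases auto
qed fact

text \<open>Greedy choice: \<open>S\<close> is added to \<open>K'\<close> only if it is not
  contained in \<open>K + K'\<close>, and then it is independent of that sum by minimality.\<close>

lemma complement_of_finite_sum:
  assumes "finite_sum \<S> B" and min: "\<S> \<subseteq> Collect minimal_left_ideal"
    and K: "left_ideal K"
  obtains K' where "finite_sum \<S> K'" "left_ideal K'" "K' \<subseteq> B" "K \<inter> K' = {0}" "B \<subseteq> K + K'"
proof -
  have "\<exists>K'. finite_sum \<S> K' \<and> K' \<subseteq> B \<and> K \<inter> K' = {0} \<and> B \<subseteq> K + K'"
    using assms(1) min
  proof (induction rule: finite_sum_induct)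
    case zero
    then show ?case
      using finite_sum.zero[of \<S>] left_idealD(1)[OF K] left_idealD(1)[OF left_ideal_plus[OF K left_ideal_zero]]
      by (intro exI[of _ "{0}"]) simp
  next
    case (add B S)
    then obtain K' where K': "finite_sum \<S> K'" "K' \<subseteq> B" "K \<inter> K' = {0}" "B \<subseteq> K + K'"
      by blast
    have S: "minimal_left_ideal S" "left_ideal S" using min add by auto
    have ideal: "left_ideal K'"
      using K'(1) finite_sum_left_ideal min by blast
    have ideal': "left_ideal (K + K')" using K ideal left_ideal_plus by blast
    show ?case
    proof (cases "S \<subseteq> K + K'")
      case True
      have "B + S \<subseteq> K + K'" using ideal' K'(4) True plus_subset by blast
      moreover have "K' \<subseteq> B + S" using K'(2) subset_plus_left[OF S(2)] by blast
      ultimately show ?thesis using K' by blast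
    next
      case False
      then have direct: "(K + K') \<inter> S = {0}"
        using minimal_left_idealD(4)[OF S(1) ideal'] by blast
      have "x = 0" if x: "x \<in> K" "x \<in> K' + S" for x
      proof -
        obtain k s where ks: "x = k + s" "k \<in> K'" "s \<in> S" using x(2) by (auto elim: set_plus_elim)
        have "s = x + (- k)" using ks by simp
        also have "\<dots> \<in> K + K'" using x ks ideal by (intro set_plus_intro) (auto intro: left_idealD)
        finally have "s = 0" using direct ks by auto
        then show ?thesis using ks x K'(3) by auto
      qed
      moreover have "0 \<in> K" "0 \<in> K' + S"
        using K left_ideal_plus[OF ideal S(2)] by (auto intro: left_idealD)
      moreover have "B + S \<subseteq> K + (K' + S)"
        using set_plus_mono2[OF K'(4) subset_refl, of S] by (simp add: add.assoc)
      moreover have "K' + S \<subseteq> B + S" using K'(2) set_plus_mono2 by blast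
      ultimately show ?thesis using finite_sum.add[OF K'(1) \<open>S \<in> \<S>\<close>] by blast
    qed
  qed
  then show thesis
    using that finite_sum_left_ideal[OF _ min] by metis
qed

text \<open>Otherwise there is a sequence of minimal left ideals, none contained in the sum of its
  predecessors; the sums of its tails then form a strictly descending chain.\<close>

lemma artinian_finite_sum:
  assumes art: "left_artinian TYPE('r::{ring,monoid_mult})"
    and min: "\<S> \<subseteq> Collect (minimal_left_ideal :: 'r set \<Rightarrow> bool)"
  obtains B where "finite_sum \<S> B" "\<And>S. S \<in> \<S> \<Longrightarrow> S \<subseteq> B"
proof (rule ccontr)
  assume "\<not> thesis"
  then have "\<exists>S. finite_sum \<S> B \<longrightarrow> S \<in> \<S> \<and> \<not> S \<subseteq> B" for B
    using that by blast
  then obtain next_ideal where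
    next_ideal: "\<And>B. finite_sum \<S> B \<Longrightarrow> next_ideal B \<in> \<S> \<and> \<not> next_ideal B \<subseteq> B"
    by metis
  define B where "B = rec_nat {0} (\<lambda>_ B. B + next_ideal B)"
  define S where "S n = next_ideal (B n)" for n
  have B_simps: "B 0 = {0}" "B (Suc n) = B n + S n" for n by (auto simp: B_def S_def)
  have B: "finite_sum \<S> (B n)" for n
    by (induction n) (auto simp: B_simps S_def intro: finite_sum.intros next_ideal[THEN conjunct1])
  have S: "S n \<in> \<S>" "\<not> S n \<subseteq> B n" for n using next_ideal[OF B] by (auto simp: S_def)
  have S_min: "minimal_left_ideal (S n)" for n using S min by blast
  then have S_ideal: "left_ideal (S n)" for n using minimal_left_idealD(1) by blast
  have B_ideal: "left_ideal (B n)" for n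
    using B finite_sum_left_ideal min by blast
  have direct: "S n \<inter> B n = {0}" for n
    using minimal_left_idealD(4)[OF S_min B_ideal] S(2) by blast
  \<comment> \<open>\<open>E k m\<close> is the sum of the \<open>S i\<close> with
    \<open>k <= i < m\<close>, and 0 for \<open>m <= k\<close>; its union over \<open>m\<close> will
    be the tail starting at \<open>k\<close>.\<close>
  define E where "E k = rec_nat {0} (\<lambda>m E. if m < k then {0} else E + S m)" for k
  have E_simps: "E k 0 = {0}" "E k (Suc m) = (if m < k then {0} else E k m + S m)" for k m
    by (auto simp: E_def)
  have E_ideal: "left_ideal (E k m)" for k m
    by (induction m) (auto simp: E_simps left_ideal_zero left_ideal_plus S_ideal)
  have E_early: "m \<le> k \<Longrightarrow> E k m = {0}" for k m by (cases m) (auto simp: E_simps)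
  have E_mono: "E k m \<subseteq> E k m'" if "m \<le> m'" for k m m'
  proof (rule lift_Suc_mono_le[OF _ that])
    show "E k n \<subseteq> E k (Suc n)" for n
      using subset_plus_left[OF S_ideal] E_early[of n k] by (auto simp: E_simps)
  qed
  have E_Suc: "E (Suc k) m \<subseteq> E k m" for k m
  proof (induction m)
    case (Suc m)
    have "0 \<in> E k m + S m" using left_ideal_plus[OF E_ideal S_ideal] left_idealD(1) by blast
    then show ?case using set_plus_mono2[OF Suc subset_refl, of "S m"] by (auto simp: E_simps)
  qed (simp add: E_simps)
  have E_B: "E k m \<subseteq> B m" for k m
  proof (induction m)
    case (Suc m)
    have "0 \<in> B (Suc m)" using B_ideal left_idealD(1) by blast
    then show ?case using set_plus_mono2[OF Suc subset_refl, of "S m"] by (auto simp: E_simps B_simps)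
  qed (simp add: E_simps B_simps)
  have B_mono: "B m \<subseteq> B m'" if "m \<le> m'" for m m'
    by (rule lift_Suc_mono_le[OF _ that]) (simp add: B_simps subset_plus_left S_ideal)
  \<comment> \<open>Independence of \<open>S k\<close> from the later summands: the last component
    \<open>s\<close> of \<open>x\<close> equals \<open>x - e\<close>, where both \<open>x\<close>
    and \<open>e\<close> lie in \<open>B m\<close>, so it is 0 by \<open>direct\<close>.\<close>
  have tail: "x = 0" if "x \<in> S k" "x \<in> E (Suc k) m" for x k m
    using that(2)
  proof (induction m)
    case (Suc m)
    show ?case
    proof (cases "m < Suc k")
      case False
      then obtain e s where es: "x = e + s" "e \<in> E (Suc k) m" "s \<in> S m"
        using Suc.prems by (auto simp: E_simps elim: set_plus_elim)
      have "x \<in> B (Suc k)"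
        using that(1) subset_plus_right[OF B_ideal] by (auto simp: B_simps)
      then have "x \<in> B m" using False B_mono[of "Suc k" m] by auto
      then have "x - e \<in> B m" using es(2) E_B left_idealD(5)[OF B_ideal] by blast
      then have "s \<in> S m \<inter> B m" using es by simp
      then have "s = 0" using direct by blast
      then show ?thesis using es Suc.IH by simp
    qed (use Suc.prems in \<open>simp add: E_simps\<close>)
  qed (simp add: E_simps)
  define T where "T k = (\<Union>m. E k m)" for k
  have "left_ideal (T k)" for k
    unfolding submodule_def T_def
  proof (intro conjI ballI allI)
    fix x y assume "x \<in> (\<Union>m. E k m)" "y \<in> (\<Union>m. E k m)"
    then obtain m m' where "x \<in> E k m" "y \<in> E k m'" by blast
    then have "x \<in> E k (max m m')" "y \<in> E k (max m m')"
      using E_mono[of m "max m m'" k] E_mono[of m' "max m m'" k] by auto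
    then show "x + y \<in> (\<Union>m. E k m)" using left_idealD(2)[OF E_ideal] by blast
  next
    show "0 \<in> (\<Union>m. E k m)" using left_idealD(1)[OF E_ideal] by blast
  next
    fix r x assume "x \<in> (\<Union>m. E k m)"
    then show "r * x \<in> (\<Union>m. E k m)" using left_idealD(3)[OF E_ideal] by blast
  qed
  moreover have "T (Suc k) \<subseteq> T k" for k
    unfolding T_def by (rule UN_mono[OF subset_refl E_Suc])
  ultimately have "\<exists>m. \<forall>k\<ge>m. T k = T m"
    using art[unfolded left_artinian_def, THEN spec[of _ T]] by blast
  then obtain m where "\<forall>k\<ge>m. T k = T m" ..
  then have T_Suc: "T (Suc m) = T m" using le_SucI[OF order_refl] by blast
  have "S m \<subseteq> E m (Suc m)"
    using subset_plus_right[OF E_ideal, of "S m" m m] by (simp add: E_simps)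
  also have "\<dots> \<subseteq> T m" unfolding T_def by blast
  finally have "S m \<subseteq> T (Suc m)" using T_Suc by simp
  then have "\<exists>n. x \<in> E (Suc m) n" if "x \<in> S m" for x using that unfolding T_def by blast
  then have "S m \<subseteq> {0}" using tail by blast
  then have "S m = {0}" using left_idealD(1)[OF S_ideal[of m]] by blast
  then show False using minimal_left_idealD(2)[OF S_min[of m]] by blast
qed

section \<open>Extension of injective homomorphisms by units\<close>

lemma direct_sum_hom:
  assumes I: "left_ideal I" and K: "left_ideal K" and direct: "I \<inter> K = {0}"
    and N: "left_ideal N" and f: "left_hom (*) I (*) N f" and g: "left_hom (*) K (*) N g"
  obtains h where "left_hom (*) (I + K) (*) N h" "\<And>a b. a \<in> I \<Longrightarrow> b \<in> K \<Longrightarrow> h (a + b) = f a + g b"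
proof
  define h where "h x = (let p = SOME p. fst p \<in> I \<and> snd p \<in> K \<and> x = fst p + snd p in f (fst p) + g (snd p))"
    for x
  show h: "h (a + b) = f a + g b" if "a \<in> I" "b \<in> K" for a b
  proof -
    define p where "p = (SOME p. fst p \<in> I \<and> snd p \<in> K \<and> a + b = fst p + snd p)"
    have p: "fst p \<in> I \<and> snd p \<in> K \<and> a + b = fst p + snd p"
      unfolding p_def by (rule someI[of _ "(a, b)"]) (use that in simp)
    have "h (a + b) = f (fst p) + g (snd p)" by (simp only: h_def p_def Let_def)
    moreover have "fst p = a" "snd p = b"
      using direct_sum_cancel[OF I K direct, of a "fst p" b "snd p"] that p by metis+
    ultimately show ?thesis by simp
  qed
  show "left_hom (*) (I + K) (*) N h"
    unfolding left_hom_def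
  proof (intro conjI ballI allI)
    fix x assume "x \<in> I + K"
    then obtain a b where x: "x = a + b" "a \<in> I" "b \<in> K" by (auto elim: set_plus_elim)
    then show "h x \<in> N" using h f g left_idealD(2)[OF N] by (simp add: left_hom_def)
    show "h (r * x) = r * h x" for r
      using x f g h[of "r * a" "r * b"] left_idealD(3)[OF I, of a r] left_idealD(3)[OF K, of b r]
      by (simp add: h distrib_left left_hom_def)
    fix y assume "y \<in> I + K"
    then obtain c d where y: "y = c + d" "c \<in> I" "d \<in> K" by (auto elim: set_plus_elim)
    have "h (x + y) = h ((a + c) + (b + d))" using x y by (simp add: algebra_simps)
    also have "\<dots> = f (a + c) + g (b + d)"
      using x y I K by (intro h) (auto intro: left_idealD)
    also have "\<dots> = h x + h y" using x y f g by (simp add: h left_hom_def)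
    finally show "h (x + y) = h x + h y" .
  qed
qed

lemma left_hom_inv_into:
  assumes I: "left_ideal I" and f: "left_hom (*) I (*) K f" "inj_on f I"
  shows "left_hom (*) (f ` I) (*) I (inv_into I f)"
  unfolding left_hom_def
proof (intro conjI ballI allI)
  fix x y assume "x \<in> f ` I" "y \<in> f ` I"
  then obtain a b where ab: "x = f a" "y = f b" "a \<in> I" "b \<in> I" by blast
  then have "x + y = f (a + b)" using f(1) by (simp add: left_hom_def)
  then show "inv_into I f (x + y) = inv_into I f x + inv_into I f y"
    using ab f(2) left_idealD(2)[OF I ab(3,4)] by simp
next
  fix r x assume "x \<in> f ` I"
  then obtain a where a: "x = f a" "a \<in> I" by blast
  then have "r * x = f (r * a)" using f(1) by (simp add: left_hom_def)
  then show "inv_into I f (r * x) = r * inv_into I f x"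
    using a f(2) left_idealD(3)[OF I a(2)] by simp
qed (rule inv_into_into)

text \<open>The chain of the left ideals \<open>R c^k\<close> becomes stationary, so
  \<open>c^m = t c^(m+1)\<close>. Right multiplication by powers of \<open>c\<close> is injective,
  hence \<open>t c = 1\<close>, and \<open>(c t - 1) c = 0\<close> then gives
  \<open>c t = 1\<close>.\<close>

lemma artinian_unit:
  assumes art: "left_artinian TYPE('r::{ring,monoid_mult})"
    and inj: "\<And>x. x * c = 0 \<Longrightarrow> x = (0::'r)"
  shows "c \<in> ring_units"
proof -
  define I where "I k = range (\<lambda>x. x * c ^ k)" for k
  have "left_ideal (I k)" for k
    unfolding I_def using left_ideal_image_mult[OF left_ideal_UNIV] .
  moreover have "I (Suc k) \<subseteq> I k" for k
    by (auto simp: I_def mult.assoc[symmetric])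
  ultimately have "\<exists>m. \<forall>k\<ge>m. I k = I m"
    using art[unfolded left_artinian_def, THEN spec[of _ I]] by blast
  then obtain m where "\<forall>k\<ge>m. I k = I m" ..
  then have "I (Suc m) = I m" using le_SucI[OF order_refl] by blast
  moreover have "c ^ m \<in> I m" unfolding I_def by (rule image_eqI[of _ _ 1]) auto
  ultimately obtain t where "c ^ m = t * c ^ Suc m" by (auto simp: I_def)
  then have "(1 - t * c) * c ^ m = 0" by (simp add: algebra_simps)
  moreover have "x = 0" if "x * c ^ k = 0" for x k
    using that
  proof (induction k arbitrary: x)
    case (Suc k)
    then have "x * c = 0" using Suc.IH[of "x * c"] by (simp add: mult.assoc)
    then show ?case by (rule inj)
  qed simp
  ultimately have "1 - t * c = 0" by blast
  then have tc: "t * c = 1" by simp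
  then have "(c * t - 1) * c = 0" by (simp add: left_diff_distrib mult.assoc)
  then have "c * t = 1" using inj[of "c * t - 1"] by simp
  with tc show ?thesis by (auto simp: ring_units_def)
qed

text \<open>If no copy of \<open>S\<close> in the ring were independent of \<open>I c\<close>, then right multiplication by a left
  inverse \<open>d\<close> of \<open>c\<close> on \<open>I\<close> would be injective but not surjective on the largest
  \<open>d\<close>-invariant submodule of \<open>I c\<close>.\<close>

lemma independent_copy:
  assumes art: "left_artinian TYPE('r::{ring,monoid_mult})"
    and pinj: "left_pseudo_injective TYPE('r)"
    and I: "left_ideal (I :: 'r set)" and inj: "\<And>x. x \<in> I \<Longrightarrow> x * c = 0 \<Longrightarrow> x = 0"
    and S: "minimal_left_ideal S" and direct: "I \<inter> S = {0}"
  obtains g where "left_hom (*) S (*) UNIV g" "inj_on g S" "(\<lambda>x. x * c) ` I \<inter> g ` S = {0}"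
proof (rule ccontr)
  note copy = that
  assume no_copy: "\<not> thesis"
  let ?Ic = "(\<lambda>x. x * c) ` I"
  have Ic: "left_ideal ?Ic" using left_ideal_image_mult[OF I] .
  have S': "left_ideal S" using minimal_left_idealD(1)[OF S] .
  have sub: "g ` S \<subseteq> ?Ic" if g: "left_hom (*) S (*) UNIV g" "inj_on g S" for g
  proof -
    note gD = ideal_homD[OF S' g(1)]
    have "left_ideal {x \<in> S. g x \<in> ?Ic}"
      unfolding submodule_def using g(1) gD(1) left_idealD[OF S'] left_idealD[OF Ic]
      by (simp add: left_hom_def)
    then consider "{x \<in> S. g x \<in> ?Ic} = {0}" | "{x \<in> S. g x \<in> ?Ic} = S"
      using minimal_left_idealD(3)[OF S, of "{x \<in> S. g x \<in> ?Ic}"] by blast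
    then show ?thesis
    proof cases
      case 1
      have "y = 0" if "y \<in> ?Ic" "y \<in> g ` S" for y
      proof -
        obtain x where x: "x \<in> S" "y = g x" using \<open>y \<in> g ` S\<close> by blast
        then have "x \<in> {x \<in> S. g x \<in> ?Ic}" using \<open>y \<in> ?Ic\<close> by blast
        then have "x = 0" unfolding 1 by simp
        then show ?thesis using x(2) gD(1) by simp
      qed
      then have "?Ic \<inter> g ` S \<subseteq> {0}" by blast
      moreover have "0 \<in> ?Ic \<inter> g ` S" using left_idealD(1)[OF Ic] left_idealD(1)[OF gD(4)] by blast
      ultimately have "?Ic \<inter> g ` S = {0}" by blast
      then show ?thesis using copy[OF g] no_copy by blast
    next
      case 2
      then show ?thesis by blast
    qed
  qed
  have c_hom: "left_hom (*) I (*) UNIV (\<lambda>x. x * c)" by (rule left_hom_mult_right)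
  have inj_c: "inj_on (\<lambda>x. x * c) I" using ideal_homD(3)[OF I c_hom] inj by blast
  define f where "f = inv_into I (\<lambda>x. x * c)"
  have f: "f (x * c) = x" if "x \<in> I" for x
    using inv_into_f_f[OF inj_c that] by (simp add: f_def)
  have "left_hom (*) ?Ic (*) UNIV f"
    using left_hom_inv_into[OF I c_hom inj_c] by (simp add: left_hom_def f_def)
  moreover have "inj_on f ?Ic" by (auto simp: inj_on_def f)
  ultimately obtain d where d: "\<forall>x\<in>?Ic. f x = x * d"
    using pinj Ic unfolding left_pseudo_injective_def by blast
  have cd: "x * c * d = x" if "x \<in> I" for x using d f that by simp
  have Ic_d: "y * d \<in> I" "y * d = 0 \<Longrightarrow> y = 0" if "y \<in> ?Ic" for y using that cd by auto
  \<comment> \<open>Injectivity of \<open>d\<close> is known on \<open>I c\<close> only, hence the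
    induction: once \<open>S d^k\<close> lies in \<open>I c\<close>, the next power of
    \<open>d\<close> is still injective on \<open>S\<close>, and \<open>sub\<close> moves its image
    into \<open>I c\<close> again.\<close>
  have S_d: "(\<forall>x\<in>S. x * d ^ k \<in> ?Ic) \<and> (\<forall>x\<in>S. x * d ^ k = 0 \<longrightarrow> x = 0)" for k
  proof (induction k)
    case 0
    have "left_hom (*) S (*) UNIV (\<lambda>x. x)" by (simp add: left_hom_def)
    then show ?case using sub[of "\<lambda>x. x"] by auto
  next
    case (Suc k)
    have ker: "\<forall>x\<in>S. x * d ^ Suc k = 0 \<longrightarrow> x = 0"
    proof (intro ballI impI)
      fix x assume x: "x \<in> S" "x * d ^ Suc k = 0"
      then have "x * d ^ k * d = 0" by (simp add: power_Suc2 mult.assoc del: power_Suc)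
      then have "x * d ^ k = 0" using Ic_d(2) Suc x(1) by blast
      then show "x = 0" using Suc x(1) by blast
    qed
    moreover have "left_hom (*) S (*) UNIV (\<lambda>x. x * d ^ Suc k)" by (rule left_hom_mult_right)
    ultimately show ?case
      using sub[of "\<lambda>x. x * d ^ Suc k"] ideal_homD(3)[OF S'] by auto
  qed
  define T where "T = {x. \<forall>k. x * d ^ k \<in> ?Ic}"
  have T_Ic: "x \<in> ?Ic" if "x \<in> T" for x
  proof -
    have "x * d ^ 0 \<in> ?Ic" using that unfolding T_def by blast
    then show ?thesis by simp
  qed
  have T_d: "x * d \<in> T" if "x \<in> T" for x
  proof -
    have "x * d ^ Suc k \<in> ?Ic" for k using that unfolding T_def by blast
    then show ?thesis unfolding T_def by (simp add: mult.assoc)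
  qed
  have T: "left_ideal T"
    unfolding submodule_def T_def using left_idealD[OF Ic] by (simp add: distrib_right mult.assoc)
  have T_inj: "x = 0" if "x * d ^ k = 0" "x \<in> T" for x k
    using that
  proof (induction k arbitrary: x)
    case (Suc k)
    then have "x * d = 0" using Suc.IH[of "x * d"] T_d by (simp add: mult.assoc)
    then show ?case using Ic_d(2) T_Ic Suc.prems(2) by blast
  qed simp
  define C where "C k = (\<lambda>x. x * d ^ k) ` T" for k
  have "left_ideal (C k)" for k unfolding C_def using left_ideal_image_mult[OF T] .
  moreover have "C (Suc k) \<subseteq> C k" for k
    using T_d by (auto simp: C_def mult.assoc[symmetric])
  ultimately have "\<exists>m. \<forall>k\<ge>m. C k = C m"
    using art[unfolded left_artinian_def, THEN spec[of _ C]] by blast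
  then obtain m where "\<forall>k\<ge>m. C k = C m" ..
  then have C_Suc: "C (Suc m) = C m" using le_SucI[OF order_refl] by blast
  \<comment> \<open>Stationarity allows \<open>d^m\<close> to be cancelled on \<open>T\<close>,
    giving \<open>s = t d\<close> with \<open>t\<close> in \<open>I c\<close>. But \<open>d\<close>
    maps \<open>I c\<close> back into \<open>I\<close>, which meets \<open>S\<close> in 0.\<close>
  have "s = 0" if s: "s \<in> S" for s
  proof -
    have sT: "s \<in> T" using S_d s by (simp add: T_def)
    then have "s * d ^ m \<in> C (Suc m)" unfolding C_Suc by (auto simp: C_def)
    then obtain t where t: "t \<in> T" "s * d ^ m = t * d ^ Suc m" by (auto simp: C_def)
    then have "(s - t * d) * d ^ m = 0" by (simp add: left_diff_distrib mult.assoc)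
    then have "s - t * d = 0" using T_inj sT t(1) T_d left_idealD(5)[OF T] by blast
    then have "s \<in> I" using Ic_d(1)[OF T_Ic[OF t(1)]] by simp
    then show ?thesis using s direct by blast
  qed
  then have "S = {0}" using left_idealD(1)[OF S'] by blast
  then show False using minimal_left_idealD(2)[OF S] by blast
qed

text \<open>If \<open>S\<close> is not inside \<open>I\<close>, it is sent to a copy independent of
  \<open>I c\<close>. The two maps then combine to an injective homomorphism on the direct sum, and
  pseudo-injectivity provides the new multiplier \<open>e\<close>.\<close>

lemma extend_over_minimal:
  assumes art: "left_artinian TYPE('r::{ring,monoid_mult})"
    and pinj: "left_pseudo_injective TYPE('r)"
    and I: "left_ideal (I :: 'r set)" and inj: "\<And>x. x \<in> I \<Longrightarrow> x * c = 0 \<Longrightarrow> x = 0"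
    and S: "minimal_left_ideal S"
  obtains e where "\<And>x. x \<in> I \<Longrightarrow> x * e = x * c" "\<And>x. x \<in> I + S \<Longrightarrow> x * e = 0 \<Longrightarrow> x = 0"
proof (cases "S \<subseteq> I")
  case True
  then have "I + S = I" using plus_absorb[OF I minimal_left_idealD(1)[OF S]] by blast
  show thesis by (rule that[of c]) (use \<open>I + S = I\<close> inj in blast)+
next
  case False
  have S': "left_ideal S" using minimal_left_idealD(1)[OF S] .
  have direct: "I \<inter> S = {0}" using minimal_left_idealD(4)[OF S I] False by blast
  obtain g where g: "left_hom (*) S (*) UNIV g" "inj_on g S" "(\<lambda>x. x * c) ` I \<inter> g ` S = {0}"
    using independent_copy[OF art pinj I inj S direct] by blast
  have IS: "left_ideal (I + S)" using left_ideal_plus[OF I S'] .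
  obtain h where h: "left_hom (*) (I + S) (*) UNIV h"
    "\<And>a b. a \<in> I \<Longrightarrow> b \<in> S \<Longrightarrow> h (a + b) = a * c + g b"
    using direct_sum_hom[OF I S' direct left_ideal_UNIV left_hom_mult_right[of I c] g(1)] by blast
  have ker: "x = 0" if x: "x \<in> I + S" "h x = 0" for x
  proof -
    obtain a b where ab: "x = a + b" "a \<in> I" "b \<in> S" using x(1) by (auto elim: set_plus_elim)
    then have "a * c + g b = 0" using x(2) h(2)[OF ab(2,3)] by metis
    then have "(- a) * c = g b" using minus_unique[of "a * c" "g b"] by simp
    moreover have "(- a) * c \<in> (\<lambda>x. x * c) ` I" using left_idealD(4)[OF I ab(2)] by blast
    ultimately have "(- a) * c = 0" "g b = 0" using g(3) ab(3) by auto
    then show ?thesis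
      using inj[of a] ab ideal_homD(3)[OF S' g(1)] g(2) by simp
  qed
  then have "inj_on h (I + S)" using ideal_homD(3)[OF IS h(1)] by blast
  then obtain e where e: "\<forall>x\<in>I + S. h x = x * e"
    using pinj IS h(1) unfolding left_pseudo_injective_def by blast
  show thesis
  proof (rule that[of e])
    fix x assume x: "x \<in> I"
    then have "x \<in> I + S" using subset_plus_left[OF S'] by blast
    then show "x * e = x * c"
      using e h(2)[OF x left_idealD(1)[OF S']] ideal_homD(1)[OF S' g(1)] by simp
  qed (use e ker in auto)
qed

lemma pseudo_injective_unit:
  assumes art: "left_artinian TYPE('r::{ring,monoid_mult})"
    and pinj: "left_pseudo_injective TYPE('r)"
    and I: "left_ideal (I :: 'r set)" and f: "left_hom (*) I (*) UNIV f" "inj_on f I"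
  obtains u where "u \<in> ring_units" "\<And>x. x \<in> I \<Longrightarrow> f x = x * u"
proof -
  let ?\<S> = "Collect (minimal_left_ideal :: 'r set \<Rightarrow> bool)"
  obtain B where B: "finite_sum ?\<S> B" "\<And>S. S \<in> ?\<S> \<Longrightarrow> S \<subseteq> B"
    using artinian_finite_sum[OF art, of ?\<S>] by blast
  \<comment> \<open>Injectivity on \<open>I + B\<close>, and not just on \<open>B\<close>, is what
    \<open>extend_over_minimal\<close> asks for when the next summand is added.\<close>
  have "\<exists>c. (\<forall>x\<in>I. f x = x * c) \<and> (\<forall>x\<in>I + B. x * c = 0 \<longrightarrow> x = 0)"
    using B(1)
  proof (induction rule: finite_sum.induct)
    case zero
    obtain c where "\<forall>x\<in>I. f x = x * c"
      using pinj I f unfolding left_pseudo_injective_def by blast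
    moreover have "I + {0} = I" by (auto simp: set_plus_def)
    ultimately show ?case using ideal_homD(3)[OF I f(1)] f(2) by auto
  next
    case (add B S)
    then obtain c where c: "\<forall>x\<in>I. f x = x * c" "\<forall>x\<in>I + B. x * c = 0 \<longrightarrow> x = 0" by blast
    have B: "left_ideal B" using finite_sum_left_ideal[OF add(1)] by blast
    have S: "minimal_left_ideal S" using add(2) by blast
    obtain e where e: "\<And>x. x \<in> I + B \<Longrightarrow> x * e = x * c" "\<And>x. x \<in> (I + B) + S \<Longrightarrow> x * e = 0 \<Longrightarrow> x = 0"
      using extend_over_minimal[OF art pinj left_ideal_plus[OF I B], of c S] c(2) S by blast
    have "\<forall>x\<in>I. f x = x * e" using c(1) e(1) subset_plus_left[OF B, of I] by auto
    then show ?case using e(2) by (auto simp: add.assoc)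
  qed
  then obtain u where u: "\<forall>x\<in>I. f x = x * u" "\<forall>x\<in>I + B. x * u = 0 \<longrightarrow> x = 0" by blast
  have "left_ideal B" using finite_sum_left_ideal[OF B(1)] by blast
  then have "B \<subseteq> I + B" using subset_plus_right[OF I] by blast
  then have ker_B: "x = 0" if "x \<in> B" "x * u = 0" for x using u(2) that by blast
  have "{x. x * u = 0} = {0}"
  proof (rule ccontr)
    assume "{x. x * u = 0} \<noteq> {0}"
    then obtain S where S: "minimal_left_ideal S" "S \<subseteq> {x. x * u = 0}"
      using contains_minimal_left_ideal[OF art left_ideal_annihilator] by blast
    then have "S \<subseteq> {0}" using ker_B B(2) by blast
    then show False using left_idealD(1)[OF minimal_left_idealD(1)[OF S(1)]] minimal_left_idealD(2)[OF S(1)] by blast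
  qed
  then have "u \<in> ring_units" using artinian_unit[OF art, of u] by blast
  with u(1) that show thesis by blast
qed

section \<open>Characters of finite abelian groups\<close>

primrec multiple :: "nat \<Rightarrow> 'a::ab_group_add \<Rightarrow> 'a" where
  "multiple 0 x = 0"
| "multiple (Suc k) x = x + multiple k x"

lemma multiple_add: "multiple (k + l) x = multiple k x + multiple l x"
  by (induction k) (auto simp: add.assoc)

lemma multiple_mult: "multiple (k * l) x = multiple k (multiple l x)"
  by (induction k) (auto simp: multiple_add)

text \<open>For finite sets this is the notion of subgroup: translation by \<open>x\<close> permutes
  the set and so reaches 0, which gives negatives (\<open>add_closed_minus\<close>).\<close>

definition add_closed :: "'a::ab_group_add set \<Rightarrow> bool" where
  "add_closed G \<longleftrightarrow> 0 \<in> G \<and> (\<forall>x\<in>G. \<forall>y\<in>G. x + y \<in> G)"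

lemma add_closed_multiple: "add_closed G \<Longrightarrow> x \<in> G \<Longrightarrow> multiple k x \<in> G"
  by (induction k) (auto simp: add_closed_def)

lemma add_closed_minus:
  assumes "finite G" "add_closed G" "x \<in> G"
  shows "- x \<in> G"
proof -
  have "(+) x ` G = G"
    by (rule endo_inj_surj) (use assms in \<open>auto simp: add_closed_def\<close>)
  then obtain y where "y \<in> G" "x + y = 0"
    using assms(2) unfolding add_closed_def by (metis imageE)
  then show ?thesis using minus_unique[of x y] by simp
qed

lemma finite_order:
  assumes "finite G" "add_closed G" "x \<in> G"
  obtains n where "n > 0" "multiple n x = 0"
proof -
  have "range (\<lambda>k. multiple k x) \<subseteq> G" using add_closed_multiple[OF assms(2,3)] by auto
  then have "finite (range (\<lambda>k. multiple k x))" using assms(1) by (rule finite_subset)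
  then have "\<not> inj (\<lambda>k. multiple k x)" using finite_imageD infinite_UNIV_nat by blast
  then obtain k l where "k \<noteq> l" "multiple k x = multiple l x" by (auto simp: inj_def)
  then obtain k l where kl: "k < l" "multiple k x = multiple l x" by (metis nat_neq_iff)
  then have "multiple (l - k) x = 0" using multiple_add[of k "l - k" x] by simp
  with kl(1) that[of "l - k"] show thesis by simp
qed

text \<open>The value 0 outside \<open>G\<close> makes a character determined by its restriction to
  \<open>G\<close>, so that characters can be counted; \<open>\<chi> 0 = 1\<close> rules out the
  zero function.\<close>

definition characters :: "'a::ab_group_add set \<Rightarrow> ('a \<Rightarrow> complex) set" where
  "characters G = {\<chi>. \<chi> 0 = 1 \<and> (\<forall>x\<in>G. \<forall>y\<in>G. \<chi> (x + y) = \<chi> x * \<chi> y) \<and> (\<forall>x. x \<notin> G \<longrightarrow> \<chi> x = 0)}"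

lemma character_multiple:
  "\<chi> \<in> characters G \<Longrightarrow> add_closed G \<Longrightarrow> x \<in> G \<Longrightarrow> \<chi> (multiple k x) = \<chi> x ^ k"
  by (induction k) (auto simp: characters_def add_closed_multiple)

lemma character_minus:
  assumes "\<chi> \<in> characters G" "finite G" "add_closed G" "x \<in> G"
  shows "\<chi> x * \<chi> (- x) = 1"
proof -
  have "\<chi> (x + (- x)) = \<chi> x * \<chi> (- x)"
    using assms add_closed_minus[OF assms(2-4)] unfolding characters_def by blast
  then show ?thesis using assms(1) by (simp add: characters_def)
qed

lemma finite_characters:
  assumes "finite G" "add_closed G"
  shows "finite (characters G)"
proof -
  define n where "n x = (SOME n. n > 0 \<and> multiple n x = 0)" for x :: 'a
  have n: "n x > 0 \<and> multiple (n x) x = 0" if "x \<in> G" for x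
    unfolding n_def using finite_order[OF assms that] by (rule someI2_ex) blast+
  define Z where "Z = (\<Union>x\<in>G. {z :: complex. z ^ n x = 1})"
  have "finite Z" unfolding Z_def using assms(1) n by (intro finite_UN_I finite_nth_roots) auto
  then have "finite {\<chi>. \<forall>x. (x \<in> G \<longrightarrow> \<chi> x \<in> Z) \<and> (x \<notin> G \<longrightarrow> \<chi> x = 0)}"
    using assms(1) by (rule finite_set_of_finite_funs[rotated])
  moreover have "\<chi> x \<in> Z" if "\<chi> \<in> characters G" "x \<in> G" for \<chi> x
  proof -
    have "\<chi> x ^ n x = \<chi> (multiple (n x) x)"
      using character_multiple[OF that(1) assms(2) that(2)] by simp
    also have "\<dots> = 1" using n[OF that(2)] that(1) by (simp add: characters_def)
    finally show ?thesis using that(2) by (auto simp: Z_def)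
  qed
  ultimately show ?thesis
    by (elim rev_finite_subset) (auto simp: characters_def)
qed

text \<open>Let \<open>n\<close> be the order of \<open>x\<close> modulo \<open>H\<close>. Each
  element of the group generated by \<open>H\<close> and \<open>x\<close> is \<open>h + k x\<close>
  for a unique \<open>k < n\<close>, and a character of \<open>H\<close> extends by any
  \<open>n\<close>-th root of its value at \<open>n x\<close>, which leaves \<open>n\<close>
  choices. So the group grows by the factor \<open>n\<close>, and the number of its characters at
  least by that factor.\<close>

lemma extend_characters:
  assumes G: "finite G" "add_closed G" and H: "add_closed H" "H \<subseteq> G" and x: "x \<in> G" "x \<notin> H"
    and card: "card H \<le> card (characters H)"
  obtains G' where "add_closed G'" "H \<subset> G'" "G' \<subseteq> G" "card G' \<le> card (characters G')"
proof -
  have fin_H: "finite H" using H(2) G(1) by (rule finite_subset)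
  define n where "n = (LEAST n. n > 0 \<and> multiple n x \<in> H)"
  have "\<exists>n. n > 0 \<and> multiple n x \<in> H"
    using finite_order[OF G x(1)] H(1) unfolding add_closed_def by metis
  then have n: "n > 0 \<and> multiple n x \<in> H" unfolding n_def by (rule LeastI_ex)
  have n_least: "k = 0" if "k < n" "multiple k x \<in> H" for k
    using not_less_Least[of k "\<lambda>n. n > 0 \<and> multiple n x \<in> H"] that unfolding n_def by auto
  define p where "p = (\<lambda>(h, k). h + multiple k x)"
  define D where "D = H \<times> {..<n}"
  define G' where "G' = p ` D"
  have reduce: "h + multiple k x = p (h + multiple (k div n) (multiple n x), k mod n)" for h k
    by (simp add: p_def add.assoc multiple_mult[symmetric] multiple_add[symmetric])
  have reduce_D: "(h + multiple (k div n) (multiple n x), k mod n) \<in> D" if "h \<in> H" for h k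
    using that n H(1) add_closed_multiple[OF H(1)] by (auto simp: D_def add_closed_def)
  have G'_mem: "h + multiple k x \<in> G'" if "h \<in> H" for h k
    unfolding G'_def reduce using reduce_D[OF that] by (rule imageI)
  have G'_cases: "\<exists>h k. h \<in> H \<and> y = h + multiple k x" if "y \<in> G'" for y
    using that by (auto simp: G'_def D_def p_def)
  have closed: "add_closed G'"
    unfolding add_closed_def
  proof (intro conjI ballI)
    show "0 \<in> G'" using G'_mem[of 0 0] H(1) by (simp add: add_closed_def)
    fix y y' assume "y \<in> G'" "y' \<in> G'"
    then obtain h k h' k' where "h \<in> H" "y = h + multiple k x" "h' \<in> H" "y' = h' + multiple k' x"
      using G'_cases by metis
    then show "y + y' \<in> G'"
      using G'_mem[of "h + h'" "k + k'"] H(1) by (simp add: add_closed_def multiple_add algebra_simps)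
  qed
  have "H \<subseteq> G'" using G'_mem[of _ 0] by auto
  moreover have "x \<in> G'" using G'_mem[of 0 1] H(1) by (simp add: add_closed_def)
  ultimately have sub: "H \<subset> G'" using x(2) by blast
  have "G' \<subseteq> G"
    using G'_cases H(2) add_closed_multiple[OF G(2) x(1)] G(2) unfolding add_closed_def by blast
  have fin_G': "finite G'" unfolding G'_def D_def using fin_H by simp
  have inj_aux: "h = h' \<and> k = k'"
    if "h \<in> H" "h' \<in> H" "k \<le> k'" "k' < n" "h + multiple k x = h' + multiple k' x" for h h' k k'
  proof -
    have "multiple (k' - k) x = h + (- h')"
      using that multiple_add[of k "k' - k" x] by (simp add: algebra_simps)
    then have "multiple (k' - k) x \<in> H"
      using that(1) add_closed_minus[OF fin_H H(1) that(2)] H(1) unfolding add_closed_def by metis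
    moreover have "k' - k < n" using that(4) by simp
    ultimately have "k' - k = 0" by (rule n_least[rotated])
    then have "k = k'" using that(3) by simp
    then show ?thesis using that by simp
  qed
  have inj: "inj_on p D"
  proof (rule inj_onI)
    fix a b assume ab: "a \<in> D" "b \<in> D" "p a = p b"
    then show "a = b"
      using inj_aux[of "fst a" "fst b" "snd a" "snd b"] inj_aux[of "fst b" "fst a" "snd b" "snd a"]
      by (cases "snd a \<le> snd b") (auto simp: D_def p_def)
  qed
  have card_G': "card G' = card H * n"
    unfolding G'_def card_image[OF inj] by (simp add: D_def card_cartesian_product)
  let ?pairs = "SIGMA \<chi>:characters H. {z. z ^ n = \<chi> (multiple n x)}"
  let ?restrict = "\<lambda>\<chi>'. (\<lambda>y. if y \<in> H then \<chi>' y else 0, \<chi>' x)"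
  have "?pairs \<subseteq> ?restrict ` characters G'"
  proof (rule subsetI)
    fix a assume "a \<in> ?pairs"
    then obtain \<chi> z where a: "a = (\<chi>, z)" and \<chi>: "\<chi> \<in> characters H" and z: "z ^ n = \<chi> (multiple n x)"
      by auto
    define \<chi>' where "\<chi>' y = (if y \<in> G' then \<chi> (fst (inv_into D p y)) * z ^ snd (inv_into D p y) else 0)" for y
    have \<chi>'_D: "\<chi>' (p (h, k)) = \<chi> h * z ^ k" if "(h, k) \<in> D" for h k
      using that inj by (simp add: \<chi>'_def G'_def)
    \<comment> \<open>By the choice of \<open>z\<close>, the formula for \<open>\<chi>'\<close> is
      valid for all \<open>k\<close>, not only for \<open>k < n\<close>; this spares a case
      distinction on carries in the proof of multiplicativity.\<close>
    have \<chi>': "\<chi>' (h + multiple k x) = \<chi> h * z ^ k" if h: "h \<in> H" for h k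
    proof -
      have "\<chi>' (h + multiple k x) = \<chi> (h + multiple (k div n) (multiple n x)) * z ^ (k mod n)"
        unfolding reduce using \<chi>'_D[OF reduce_D[OF h]] .
      also have "\<chi> (h + multiple (k div n) (multiple n x)) = \<chi> h * \<chi> (multiple (k div n) (multiple n x))"
        using \<chi> h n add_closed_multiple[OF H(1)] by (simp add: characters_def)
      also have "\<chi> (multiple (k div n) (multiple n x)) = z ^ (n * (k div n))"
        using character_multiple[OF \<chi> H(1)] n z by (simp add: power_mult)
      finally show ?thesis by (simp add: power_add[symmetric] mult.assoc)
    qed
    have "\<chi>' \<in> characters G'"
      unfolding characters_def
    proof (intro CollectI conjI ballI allI impI)
      show "\<chi>' 0 = 1" using \<chi>'[of 0 0] H(1) \<chi> by (simp add: add_closed_def characters_def)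
      fix y y' assume "y \<in> G'" "y' \<in> G'"
      then obtain h k h' k' where y: "h \<in> H" "y = h + multiple k x" "h' \<in> H" "y' = h' + multiple k' x"
        using G'_cases by metis
      then have "y + y' = (h + h') + multiple (k + k') x" by (simp add: multiple_add algebra_simps)
      moreover have "h + h' \<in> H" using y H(1) by (simp add: add_closed_def)
      ultimately have "\<chi>' (y + y') = \<chi> (h + h') * z ^ (k + k')" using \<chi>' by simp
      also have "\<chi> (h + h') = \<chi> h * \<chi> h'" using \<chi> y by (simp add: characters_def)
      finally show "\<chi>' (y + y') = \<chi>' y * \<chi>' y'" using y \<chi>' by (simp add: power_add)
    qed (simp add: \<chi>'_def)
    moreover have "\<chi>' y = \<chi> y" if "y \<in> H" for y using \<chi>'[OF that, of 0] by simp
    then have "(\<lambda>y. if y \<in> H then \<chi>' y else 0) = \<chi>" using \<chi> by (auto simp: characters_def)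
    moreover have "\<chi>' x = z" using \<chi>'[of 0 1] H(1) \<chi> by (simp add: add_closed_def characters_def)
    ultimately show "a \<in> ?restrict ` characters G'" unfolding a by (metis (no_types, lifting) image_eqI)
  qed
  then have "card ?pairs \<le> card (characters G')"
    using finite_characters[OF fin_G' closed] by (rule surj_card_le[rotated])
  moreover have "card ?pairs = card (characters H) * n"
  proof -
    have "card {z. z ^ n = \<chi> (multiple n x)} = n" if "\<chi> \<in> characters H" for \<chi>
      using character_minus[OF that fin_H H(1), of "multiple n x"] n by (intro card_nth_roots) auto
    then show ?thesis
      using finite_characters[OF fin_H H(1)] finite_nth_roots n by (subst card_SigmaI) simp_all
  qed
  ultimately have "card G' \<le> card (characters G')"
    using card mult_le_mono1[OF card, of n] card_G' by linarith
  with closed sub \<open>G' \<subseteq> G\<close> that show thesis by blast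
qed

text \<open>A maximal subgroup satisfying the bound must be \<open>G\<close>, by
  \<open>extend_characters\<close>. The bound guarantees enough characters to choose from in
  \<open>faithful_character\<close>.\<close>

lemma card_characters:
  assumes G: "finite G" "add_closed G"
  shows "card G \<le> card (characters G)"
proof -
  let ?P = "{H. add_closed H \<and> H \<subseteq> G \<and> card H \<le> card (characters H)}"
  have "finite ?P" by (rule finite_subset[of _ "Pow G"]) (use G(1) in auto)
  moreover have "{0} \<in> ?P"
  proof -
    have closed: "add_closed {0 :: 'a}" by (simp add: add_closed_def)
    have "(\<lambda>x. if x = 0 then 1 else 0) \<in> characters {0 :: 'a}" by (simp add: characters_def)
    then have "card (characters {0 :: 'a}) > 0" using finite_characters[OF _ closed] card_gt_0_iff by blast
    then show ?thesis using closed G(2) by (simp add: add_closed_def)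
  qed
  then have "?P \<noteq> {}" by blast
  ultimately have "\<exists>H\<in>?P. \<forall>H'\<in>?P. H \<subseteq> H' \<longrightarrow> H = H'"
    by (rule finite_has_maximal)
  then obtain H where H: "H \<in> ?P" "\<forall>H'\<in>?P. H \<subseteq> H' \<longrightarrow> H = H'" by (rule bexE)
  have "H = G"
  proof (rule ccontr)
    assume "H \<noteq> G"
    then obtain x where "x \<in> G" "x \<notin> H" using H(1) by blast
    then obtain G' where "add_closed G'" "H \<subset> G'" "G' \<subseteq> G" "card G' \<le> card (characters G')"
      using extend_characters[OF G, of H x] H(1) by blast
    then show False using H(2) by blast
  qed
  then show ?thesis using H(1) by blast
qed

section \<open>Faithful characters of principal semisimple left ideals\<close>

lemma left_ideal_add_closed: "left_ideal I \<Longrightarrow> add_closed I"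
  by (auto simp: submodule_def add_closed_def)

lemma direct_sum_projections:
  assumes I: "left_ideal I" and K: "left_ideal K" and direct: "I \<inter> K = {0}"
  obtains p q where "left_hom (*) (I + K) (*) I p" "left_hom (*) (I + K) (*) K q"
    "\<And>a b. a \<in> I \<Longrightarrow> b \<in> K \<Longrightarrow> p (a + b) = a" "\<And>a b. a \<in> I \<Longrightarrow> b \<in> K \<Longrightarrow> q (a + b) = b"
proof -
  have homs: "left_hom (*) I (*) I (\<lambda>x. x)" "left_hom (*) K (*) K (\<lambda>x. x)"
    "left_hom (*) I (*) K (\<lambda>x. 0)" "left_hom (*) K (*) I (\<lambda>x. 0)"
    using left_idealD(1)[OF I] left_idealD(1)[OF K] by (auto simp: left_hom_def)
  obtain p where p: "left_hom (*) (I + K) (*) I p" "\<And>a b. a \<in> I \<Longrightarrow> b \<in> K \<Longrightarrow> p (a + b) = a + 0"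
    using direct_sum_hom[OF I K direct I homs(1,4)] by blast
  obtain q where q: "left_hom (*) (I + K) (*) K q" "\<And>a b. a \<in> I \<Longrightarrow> b \<in> K \<Longrightarrow> q (a + b) = 0 + b"
    using direct_sum_hom[OF I K direct K homs(3,2)] by blast
  show thesis using that[OF p(1) q(1)] p(2) q(2) by simp
qed

section \<open>Counting homomorphisms between left ideals\<close>

lemma left_hom_comp:
  "left_hom s\<^sub>1 X s\<^sub>2 Y f \<Longrightarrow> left_hom s\<^sub>2 Y s\<^sub>3 Z g \<Longrightarrow> left_hom s\<^sub>1 X s\<^sub>3 Z (\<lambda>x. g (f x))"
  by (simp add: left_hom_def)

lemma left_hom_mono:
  "left_hom s\<^sub>1 X s\<^sub>2 Y f \<Longrightarrow> X' \<subseteq> X \<Longrightarrow> Y \<subseteq> Y' \<Longrightarrow> left_hom s\<^sub>1 X' s\<^sub>2 Y' f"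
  unfolding left_hom_def by (meson subsetD)

text \<open>The value 0 outside \<open>X\<close> makes equality of homomorphisms equality of
  functions, so finite Hom groups can be counted with \<open>card\<close>.\<close>

definition ideal_homs :: "'r::{ring,monoid_mult} set \<Rightarrow> 'r set \<Rightarrow> ('r \<Rightarrow> 'r) set" where
  "ideal_homs X Y = {f. left_hom (*) X (*) Y f \<and> (\<forall>x. x \<notin> X \<longrightarrow> f x = 0)}"

lemma finite_ideal_homs: "finite X \<Longrightarrow> finite Y \<Longrightarrow> finite (ideal_homs X Y)"
  by (rule finite_subset[OF _ finite_set_of_finite_funs[of X Y 0]])
    (auto simp: ideal_homs_def left_hom_def)

lemma restrict_ideal_homs:
  "left_ideal X \<Longrightarrow> left_hom (*) X (*) Y f \<Longrightarrow> (\<lambda>x. if x \<in> X then f x else 0) \<in> ideal_homs X Y"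
  unfolding ideal_homs_def left_hom_def submodule_def by simp

lemma ideal_homs_zero: "left_ideal Y \<Longrightarrow> (\<lambda>_. 0) \<in> ideal_homs X Y"
  by (auto simp: ideal_homs_def left_hom_def left_idealD(1))

text \<open>By minimality a nonzero homomorphism \<open>\<theta>\<close> from \<open>S\<close> to
  \<open>T\<close> is an isomorphism, and composing \<open>f\<close> on both sides with the inverse
  of \<open>\<theta>\<close> is an injection into the other Hom group. Without a nonzero
  homomorphism the left side is at most 1.\<close>

lemma card_ideal_homs_minimal:
  assumes S: "minimal_left_ideal S" "finite S" and T: "minimal_left_ideal T" "finite T"
  shows "card (ideal_homs S T) \<le> card (ideal_homs T S)"
proof (cases "ideal_homs S T \<subseteq> {\<lambda>_. 0}")
  case True
  then have "card (ideal_homs S T) \<le> card {\<lambda>_ :: 'a. 0 :: 'a}" by (rule card_mono[rotated]) simp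
  moreover have "ideal_homs T S \<noteq> {}"
    using ideal_homs_zero[OF minimal_left_idealD(1)[OF S(1)]] by blast
  then have "card (ideal_homs T S) > 0"
    using finite_ideal_homs[OF T(2) S(2)] by (simp add: card_gt_0_iff)
  ultimately show ?thesis by simp
next
  case False
  have S': "left_ideal S" and T': "left_ideal T" using S T minimal_left_idealD(1) by blast+
  obtain \<theta> where \<theta>: "\<theta> \<in> ideal_homs S T" "\<theta> \<noteq> (\<lambda>_. 0)" using False by blast
  then have hom: "left_hom (*) S (*) T \<theta>" by (simp add: ideal_homs_def)
  obtain x where x: "\<theta> x \<noteq> 0" using \<theta>(2) by blast
  then have xS: "x \<in> S" using \<theta>(1) unfolding ideal_homs_def by blast
  note homD = ideal_homD[OF S' hom]
  have "left_ideal {x \<in> S. \<theta> x = 0}"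
    using S' homD(1) hom unfolding submodule_def left_hom_def by simp
  moreover have "{x \<in> S. \<theta> x = 0} \<noteq> S" using x xS by blast
  ultimately have "{x \<in> S. \<theta> x = 0} = {0}"
    using minimal_left_idealD(3)[OF S(1), of "{x \<in> S. \<theta> x = 0}"] by blast
  then have inj: "inj_on \<theta> S" unfolding homD(3) by blast
  have "\<theta> ` S \<subseteq> T" using hom by (auto simp: left_hom_def)
  moreover have "\<theta> ` S \<noteq> {0}" using x xS by blast
  ultimately have image: "\<theta> ` S = T" using minimal_left_idealD(3)[OF T(1) homD(4)] by blast
  define \<theta>' where "\<theta>' = inv_into S \<theta>"
  have hom': "left_hom (*) T (*) S \<theta>'"
    using left_hom_inv_into[OF S' hom inj] unfolding image \<theta>'_def .
  have \<theta>': "\<theta>' (\<theta> y) = y" if "y \<in> S" for y using that inj by (simp add: \<theta>'_def)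
  have \<theta>'_inj: "inj_on \<theta>' T" unfolding \<theta>'_def using image inj_on_inv_into by blast
  define F where "F f = (\<lambda>y. if y \<in> T then \<theta>' (f (\<theta>' y)) else 0)" for f
  show ?thesis
  proof (rule card_inj_on_le[of F])
    show "F ` ideal_homs S T \<subseteq> ideal_homs T S"
    proof (rule image_subsetI)
      fix f assume "f \<in> ideal_homs S T"
      then have "left_hom (*) S (*) T f" by (simp add: ideal_homs_def)
      then have "left_hom (*) T (*) S (\<lambda>y. \<theta>' (f (\<theta>' y)))"
        by (intro left_hom_comp[OF left_hom_comp[OF hom'] hom'])
      then show "F f \<in> ideal_homs T S" unfolding F_def by (rule restrict_ideal_homs[OF T'])
    qed
    show "inj_on F (ideal_homs S T)"
    proof (rule inj_onI)
      fix f g assume fg: "f \<in> ideal_homs S T" "g \<in> ideal_homs S T" "F f = F g"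
      show "f = g"
      proof
        fix y show "f y = g y"
        proof (cases "y \<in> S")
          case True
          then have "\<theta> y \<in> T" using image by blast
          then have "\<theta>' (f y) = \<theta>' (g y)"
            using fun_cong[OF fg(3), of "\<theta> y"] \<theta>'[OF True] by (simp add: F_def)
          moreover have "f y \<in> T" "g y \<in> T" using fg(1,2) True by (simp_all add: ideal_homs_def left_hom_def)
          ultimately show ?thesis using \<theta>'_inj by (simp add: inj_on_eq_iff)
        qed (use fg(1,2) in \<open>simp add: ideal_homs_def\<close>)
      qed
    qed
  qed (rule finite_ideal_homs[OF T(2) S(2)])
qed

lemma finite_finite_sum:
  "finite_sum \<S> B \<Longrightarrow> (\<And>S. S \<in> \<S> \<Longrightarrow> finite S) \<Longrightarrow> finite B"
  by (induction rule: finite_sum.induct) (auto intro: finite_set_plus)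

text \<open>A homomorphism into a direct sum is a pair of homomorphisms, and so is one out of it.
  Both counts are therefore multiplicative, which reduces the claim to minimal summands, where
  \<open>card_ideal_homs_minimal\<close> applies.\<close>

lemma card_ideal_homs_le:
  assumes "finite_sum \<S> B" and min: "\<S> \<subseteq> Collect minimal_left_ideal"
    and fin: "\<And>S. S \<in> \<S> \<Longrightarrow> finite S" and S: "minimal_left_ideal S" "finite S"
  shows "card (ideal_homs S B) \<le> card (ideal_homs B S)"
  using assms(1,2)
proof (induction rule: finite_sum_induct)
  case zero
  have "ideal_homs S {0} \<subseteq> {\<lambda>_. 0}"
    unfolding ideal_homs_def left_hom_def by (auto simp: fun_eq_iff) blast
  then have "card (ideal_homs S {0}) \<le> card {\<lambda>_ :: 'a. 0 :: 'a}" by (rule card_mono[rotated]) simp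
  moreover have "ideal_homs {0} S \<noteq> {}"
    using ideal_homs_zero[OF minimal_left_idealD(1)[OF S(1)]] by blast
  then have "card (ideal_homs {0} S) > 0"
    using finite_ideal_homs[of "{0}" S] S(2) by (simp add: card_gt_0_iff)
  ultimately show ?case by simp
next
  case (add B T)
  have T: "minimal_left_ideal T" "finite T" using min fin \<open>T \<in> \<S>\<close> by auto
  have fin_B: "finite B" using finite_finite_sum[OF \<open>finite_sum \<S> B\<close> fin] .
  have S': "left_ideal S" using minimal_left_idealD(1)[OF S(1)] .
  note B = \<open>left_ideal B\<close> and T' = \<open>left_ideal T\<close> and direct = \<open>B \<inter> T = {0}\<close>
  have BT: "left_ideal (B + T)" using left_ideal_plus[OF B T'] .
  obtain p q where pq: "left_hom (*) (B + T) (*) B p" "left_hom (*) (B + T) (*) T q"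
    "\<And>a b. a \<in> B \<Longrightarrow> b \<in> T \<Longrightarrow> p (a + b) = a" "\<And>a b. a \<in> B \<Longrightarrow> b \<in> T \<Longrightarrow> q (a + b) = b"
    using direct_sum_projections[OF B T' direct] by metis
  have "card (ideal_homs S (B + T)) \<le> card (ideal_homs S B \<times> ideal_homs S T)"
  proof (rule surj_card_le)
    show "finite (ideal_homs S B \<times> ideal_homs S T)"
      using finite_ideal_homs S(2) fin_B T(2) by blast
    show "ideal_homs S (B + T) \<subseteq> (\<lambda>(f, g) x. f x + g x) ` (ideal_homs S B \<times> ideal_homs S T)"
    proof
      fix h assume h: "h \<in> ideal_homs S (B + T)"
      then have hom: "left_hom (*) S (*) (B + T) h" by (simp add: ideal_homs_def)
      let ?f = "\<lambda>x. if x \<in> S then p (h x) else 0" and ?g = "\<lambda>x. if x \<in> S then q (h x) else 0"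
      have "?f \<in> ideal_homs S B" "?g \<in> ideal_homs S T"
        using left_hom_comp[OF hom pq(1)] left_hom_comp[OF hom pq(2)] by (auto intro: restrict_ideal_homs[OF S'])
      moreover have "h x = ?f x + ?g x" for x
      proof (cases "x \<in> S")
        case True
        then have "h x \<in> B + T" using hom by (simp add: left_hom_def)
        then obtain a b where "h x = a + b" "a \<in> B" "b \<in> T" by (auto elim: set_plus_elim)
        then show ?thesis using pq(3,4) True by simp
      qed (use h in \<open>simp add: ideal_homs_def\<close>)
      then have "h = (\<lambda>(f, g) x. f x + g x) (?f, ?g)" by auto
      ultimately show "h \<in> (\<lambda>(f, g) x. f x + g x) ` (ideal_homs S B \<times> ideal_homs S T)" by blast
    qed
  qed
  also have "\<dots> \<le> card (ideal_homs B S \<times> ideal_homs T S)"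
    unfolding card_cartesian_product
    by (intro mult_le_mono add.IH card_ideal_homs_minimal S T)
  also have "\<dots> \<le> card (ideal_homs (B + T) S)"
  proof (rule surj_card_le)
    let ?F = "\<lambda>h. (\<lambda>x. if x \<in> B then h x else 0, \<lambda>x. if x \<in> T then h x else (0 :: 'a))"
    show "finite (ideal_homs (B + T) S)"
      using finite_ideal_homs finite_set_plus[OF fin_B T(2)] S(2) by blast
    show "ideal_homs B S \<times> ideal_homs T S \<subseteq> ?F ` ideal_homs (B + T) S"
    proof (rule subsetI)
      fix a assume "a \<in> ideal_homs B S \<times> ideal_homs T S"
      then obtain f g where a: "a = (f, g)" and fg: "f \<in> ideal_homs B S" "g \<in> ideal_homs T S" by blast
      then have homs: "left_hom (*) B (*) S f" "left_hom (*) T (*) S g" by (simp_all add: ideal_homs_def)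
      obtain h where h: "left_hom (*) (B + T) (*) S h" "\<And>a b. a \<in> B \<Longrightarrow> b \<in> T \<Longrightarrow> h (a + b) = f a + g b"
        using direct_sum_hom[OF B T' direct S' homs] by blast
      let ?h = "\<lambda>x. if x \<in> B + T then h x else 0"
      have "?h x = f x" if "x \<in> B" for x
        using h(2)[OF that left_idealD(1)[OF T']] that subset_plus_left[OF T', of B] ideal_homD(1)[OF T' homs(2)]
        by auto
      moreover have "?h x = g x" if "x \<in> T" for x
        using h(2)[OF left_idealD(1)[OF B] that] that subset_plus_right[OF B, of T] ideal_homD(1)[OF B homs(1)]
        by auto
      ultimately have F: "a = ?F ?h"
        unfolding a using fg by (auto simp: ideal_homs_def fun_eq_iff)
      have "?h \<in> ideal_homs (B + T) S" using restrict_ideal_homs[OF BT h(1)] .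
      with F show "a \<in> ?F ` ideal_homs (B + T) S" by (rule image_eqI)
    qed
  qed
  finally show ?case .
qed

text \<open>The character is built one minimal summand \<open>S\<close> at a time. A character \<open>\<psi>\<close> of \<open>S\<close> is an
  unsuitable choice only if it is the pullback of \<open>\<chi>\<close> along some homomorphism \<open>S \<rightarrow> B\<close>; there are fewer
  than \<open>card S\<close> of these, because the generator of \<open>B + S\<close> separates the homomorphisms \<open>B \<rightarrow> S\<close> and
  its component in \<open>S\<close> is not a value of any of them.\<close>

lemma faithful_character:
  assumes "finite_sum \<S> B" and min: "\<S> \<subseteq> Collect minimal_left_ideal"
    and fin: "\<And>S. S \<in> \<S> \<Longrightarrow> finite S" and B: "B = range (\<lambda>r. r * a)"
  obtains \<chi> where "\<chi> \<in> characters B"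
    "\<And>K. left_ideal K \<Longrightarrow> K \<subseteq> B \<Longrightarrow> K \<noteq> {0} \<Longrightarrow> \<exists>x\<in>K. \<chi> x \<noteq> 1"
proof -
  have "\<exists>\<chi>\<in>characters B. \<forall>K. left_ideal K \<and> K \<subseteq> B \<and> K \<noteq> {0} \<longrightarrow> (\<exists>x\<in>K. \<chi> x \<noteq> 1)"
    using assms(1,2) B
  proof (induction arbitrary: a rule: finite_sum_induct)
    case zero
    have "(\<lambda>x. if x = 0 then 1 else 0) \<in> characters {0 :: 'a}" by (simp add: characters_def)
    then show ?case using left_idealD(1) by blast
  next
    case (add B S)
    have S: "minimal_left_ideal S" "finite S" using min fin \<open>S \<in> \<S>\<close> by auto
    have fin_B: "finite B" using finite_finite_sum[OF \<open>finite_sum \<S> B\<close> fin] .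
    note B = \<open>left_ideal B\<close> and S' = \<open>left_ideal S\<close> and direct = \<open>B \<inter> S = {0}\<close>
      and gen = \<open>B + S = range (\<lambda>r. r * a)\<close>
    have BS: "left_ideal (B + S)" using left_ideal_plus[OF B S'] .
    note cancel = direct_sum_cancel[OF B S' direct]
    have "1 * a \<in> B + S" unfolding gen by blast
    then obtain b s where a: "a = b + s" and b: "b \<in> B" and s: "s \<in> S" by (auto elim: set_plus_elim)
    have gen': "\<exists>r. x = r * b \<and> y = r * s" if "x \<in> B" "y \<in> S" for x y
    proof -
      have "x + y \<in> B + S" using that by blast
      then obtain r where "x + y = r * b + r * s" unfolding gen a by (auto simp: distrib_left)
      then show ?thesis
        using cancel[of x "r * b" y "r * s"] that b s left_idealD(3)[OF B b] left_idealD(3)[OF S' s] by blast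
    qed
    have "B = range (\<lambda>r. r * b)"
      using gen'[OF _ left_idealD(1)[OF S']] left_idealD(3)[OF B b] by blast
    then have "\<exists>\<chi>\<in>characters B. \<forall>K. left_ideal K \<and> K \<subseteq> B \<and> K \<noteq> {0} \<longrightarrow> (\<exists>x\<in>K. \<chi> x \<noteq> 1)"
      by (rule add.IH)
    then obtain \<chi> where \<chi>: "\<chi> \<in> characters B"
      "\<forall>K. left_ideal K \<and> K \<subseteq> B \<and> K \<noteq> {0} \<longrightarrow> (\<exists>x\<in>K. \<chi> x \<noteq> 1)"
      by (rule bexE)
    have "card (ideal_homs B S) < card S"
    proof -
      have "inj_on (\<lambda>h. h b) (ideal_homs B S)"
      proof (rule inj_onI)
        fix h h' assume hh': "h \<in> ideal_homs B S" "h' \<in> ideal_homs B S" "h b = h' b"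
        show "h = h'"
        proof
          fix x show "h x = h' x"
          proof (cases "x \<in> B")
            case True
            then obtain r where "x = r * b" using gen'[OF _ left_idealD(1)[OF S']] by blast
            then show ?thesis using hh' b by (simp add: ideal_homs_def left_hom_def)
          qed (use hh' in \<open>simp add: ideal_homs_def\<close>)
        qed
      qed
      then have "card (ideal_homs B S) = card ((\<lambda>h. h b) ` ideal_homs B S)" by (simp add: card_image)
      \<comment> \<open>If \<open>h b = s\<close>, then \<open>gen'\<close> with first component 0
        writes any \<open>y\<close> in \<open>S\<close> as \<open>r * s\<close> with
        \<open>r * b = 0\<close>, so \<open>y = h (r * b) = 0\<close>.\<close>
      moreover have "h b \<noteq> s" if h: "h \<in> ideal_homs B S" for h
      proof
        assume hb: "h b = s"
        have hom: "left_hom (*) B (*) S h" using h by (simp add: ideal_homs_def)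
        have "y = 0" if y: "y \<in> S" for y
        proof -
          obtain r where r: "0 = r * b" "y = r * s" using gen'[OF left_idealD(1)[OF B] y] by blast
          moreover have "h (r * b) = r * h b" using hom b unfolding left_hom_def by blast
          ultimately have "y = h (r * b)" using hb by simp
          then show ?thesis using r(1)[symmetric] ideal_homD(1)[OF B hom] by simp
        qed
        then have "S = {0}" using left_idealD(1)[OF S'] by blast
        then show False using minimal_left_idealD(2)[OF S(1)] by blast
      qed
      then have "s \<notin> (\<lambda>h. h b) ` ideal_homs B S" by blast
      then have "(\<lambda>h. h b) ` ideal_homs B S \<subset> S"
        using b s by (auto simp: ideal_homs_def left_hom_def)
      then have "card ((\<lambda>h. h b) ` ideal_homs B S) < card S" by (rule psubset_card_mono[OF S(2)])
      ultimately show ?thesis by simp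
    qed
    \<comment> \<open>The count that leaves room for \<open>\<psi>\<close>: \<open>P\<close> is no
      larger than the set of homomorphisms from \<open>S\<close> to \<open>B\<close>, which is
      smaller than \<open>S\<close>, whereas \<open>card_characters\<close> supplies at least
      \<open>card S\<close> characters.\<close>
    then have "card (ideal_homs S B) < card S"
      using card_ideal_homs_le[OF \<open>finite_sum \<S> B\<close> min fin S] by simp
    moreover define P where "P = (\<lambda>g y. if y \<in> S then \<chi> (g y) else 0) ` ideal_homs S B"
    have fin_P: "finite P" unfolding P_def using finite_ideal_homs[OF S(2) fin_B] by simp
    have "card P \<le> card (ideal_homs S B)"
      unfolding P_def using finite_ideal_homs[OF S(2) fin_B] by (rule card_image_le)
    ultimately have "card P < card (characters S)"
      using card_characters[OF S(2) left_ideal_add_closed[OF S']] by simp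
    then have "\<not> characters S \<subseteq> P" using card_mono[OF fin_P] by (metis not_le)
    then obtain \<psi> where \<psi>: "\<psi> \<in> characters S" "\<psi> \<notin> P" by blast
    obtain p q where p: "left_hom (*) (B + S) (*) B p" and q: "left_hom (*) (B + S) (*) S q"
      and pq: "\<And>a b. a \<in> B \<Longrightarrow> b \<in> S \<Longrightarrow> p (a + b) = a" "\<And>a b. a \<in> B \<Longrightarrow> b \<in> S \<Longrightarrow> q (a + b) = b"
      using direct_sum_projections[OF B S' direct] by metis
    have split: "x = p x + q x" if x: "x \<in> B + S" for x
      using x pq by (auto elim!: set_plus_elim)
    have pB: "p x \<in> B" and qS: "q x \<in> S" if "x \<in> B + S" for x
      using that p q by (simp_all add: left_hom_def)
    define \<chi>' where "\<chi>' x = (if x \<in> B + S then \<chi> (p x) * \<psi> (q x) else 0)" for x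
    have "\<chi>' \<in> characters (B + S)"
      unfolding characters_def
    proof (intro CollectI conjI ballI allI impI)
      show "\<chi>' 0 = 1"
        using left_idealD(1)[OF BS] ideal_homD(1)[OF BS p] ideal_homD(1)[OF BS q] \<chi>(1) \<psi>(1)
        by (simp add: \<chi>'_def characters_def)
      fix x y assume xy: "x \<in> B + S" "y \<in> B + S"
      then have "p (x + y) = p x + p y" "q (x + y) = q x + q y"
        using p q by (simp_all add: left_hom_def)
      then show "\<chi>' (x + y) = \<chi>' x * \<chi>' y"
        using left_idealD(2)[OF BS xy] xy pB[OF xy(1)] pB[OF xy(2)] qS[OF xy(1)] qS[OF xy(2)] \<chi>(1) \<psi>(1)
        by (simp add: \<chi>'_def characters_def)
    qed (simp add: \<chi>'_def)
    moreover have "\<exists>x\<in>K. \<chi>' x \<noteq> 1" if K: "left_ideal K" "K \<subseteq> B + S" "K \<noteq> {0}" for K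
    proof (rule ccontr)
      assume "\<not> (\<exists>x\<in>K. \<chi>' x \<noteq> 1)"
      then have trivial: "\<chi> (p x) * \<psi> (q x) = 1" if "x \<in> K" for x
        using that K(2) unfolding \<chi>'_def by (metis subsetD)
      have KB: "K \<inter> B = {0}"
      proof (rule ccontr)
        assume "K \<inter> B \<noteq> {0}"
        then obtain x where x: "x \<in> K" "x \<in> B" "\<chi> x \<noteq> 1"
          using \<chi>(2) left_ideal_inter[OF K(1) B] by blast
        then show False
          using trivial[OF x(1)] pq[OF x(2) left_idealD(1)[OF S']] \<psi>(1) by (simp add: characters_def)
      qed
      have qK: "left_hom (*) K (*) S q" using left_hom_mono[OF q K(2) subset_refl] .
      have ker: "x = 0" if "x \<in> K" "q x = 0" for x
      proof -
        have "x \<in> B + S" using that(1) K(2) by blast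
        then have "x \<in> B" using split[of x] pB[of x] that(2) by simp
        then show ?thesis using that(1) KB by blast
      qed
      then have inj: "inj_on q K" unfolding ideal_homD(3)[OF K(1) qK] by blast
      have "q ` K \<subseteq> S" using qK by (auto simp: left_hom_def)
      moreover have "q ` K \<noteq> {0}" using ker K(3) left_idealD(1)[OF K(1)] by blast
      ultimately have image: "q ` K = S"
        using minimal_left_idealD(3)[OF S(1) ideal_homD(4)[OF K(1) qK]] by blast
      define k where "k = inv_into K q"
      have k: "left_hom (*) S (*) (B + S) k"
        using left_hom_mono[OF left_hom_inv_into[OF K(1) qK inj] subset_refl K(2)] unfolding image k_def .
      have k_mem: "k y \<in> K" "q (k y) = y" if "y \<in> S" for y
        using that image by (auto simp: k_def inv_into_into f_inv_into_f)
      \<comment> \<open>\<open>K\<close> meets \<open>B\<close> in 0 and projects onto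
        \<open>S\<close>, so it is the graph of a homomorphism from \<open>S\<close> to
        \<open>B\<close>. Triviality of \<open>\<chi>'\<close> on it relates \<open>\<chi>\<close>
        to the inverse of \<open>\<psi>\<close>; the minus sign undoes the inversion.\<close>
      let ?g = "\<lambda>y. p (k (- y))"
      have "left_hom (*) S (*) S uminus" using left_idealD(4)[OF S'] by (simp add: left_hom_def)
      then have "left_hom (*) S (*) B ?g" by (intro left_hom_comp[OF left_hom_comp[OF _ k] p])
      then have g: "(\<lambda>y. if y \<in> S then ?g y else 0) \<in> ideal_homs S B" by (rule restrict_ideal_homs[OF S'])
      have "\<psi> y = (if y \<in> S then \<chi> (if y \<in> S then ?g y else 0) else 0)" for y
      proof (cases "y \<in> S")
        case True
        then have y: "- y \<in> S" by (rule left_idealD(4)[OF S'])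
        have "\<chi> (?g y) * \<psi> (- y) = 1" using trivial[OF k_mem(1)[OF y]] k_mem(2)[OF y] by simp
        moreover have "\<psi> y * \<psi> (- y) = 1"
          using character_minus[OF \<psi>(1) S(2) left_ideal_add_closed[OF S'] True] .
        ultimately have "\<chi> (?g y) = \<psi> y" by (metis mult.right_neutral mult.left_commute mult.commute)
        then show ?thesis using True by simp
      qed (use \<psi>(1) in \<open>simp add: characters_def\<close>)
      then have "\<psi> \<in> P" unfolding P_def using g by (intro image_eqI[OF ext]) auto
      then show False using \<psi>(2) by blast
    qed
    ultimately show ?case by blast
  qed
  then show thesis using that by blast
qed

section \<open>Embeddings into the semisimple quotient\<close>

lemma left_ideal_sum:
  assumes "left_ideal I" "\<And>x. x \<in> F \<Longrightarrow> f x \<in> I"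
  shows "sum f F \<in> I"
  using assms(2)
  by (induction F rule: infinite_finite_induct) (auto simp: left_idealD[OF assms(1)])

lemma sum_of_submodules_finite_sum:
  assumes "finite_sum \<S> B" and min: "\<S> \<subseteq> Collect minimal_left_ideal" and B: "\<And>S. S \<in> \<S> \<Longrightarrow> S \<subseteq> B"
  shows "sum_of_submodules \<S> = B"
proof
  have ideal: "left_ideal B" using finite_sum_left_ideal[OF assms(1) min] .
  show "sum_of_submodules \<S> \<subseteq> B"
    unfolding sum_of_submodules_def using B by (auto intro!: left_ideal_sum[OF ideal])
  show "B \<subseteq> sum_of_submodules \<S>"
    using assms(1)
  proof (induction rule: finite_sum.induct)
    case zero
    have "(0 :: 'a) = sum (\<lambda>_. 0) ({} :: 'a set set)" by simp
    then show ?case unfolding sum_of_submodules_def by blast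
  next
    case (add B S)
    show ?case
    proof
      fix x assume "x \<in> B + S"
      then obtain b s where x: "x = b + s" "b \<in> B" "s \<in> S" by (auto elim: set_plus_elim)
      then obtain f F where f: "b = sum f F" "finite F" "F \<subseteq> \<S>" "\<forall>A\<in>F. f A \<in> A"
        using add.IH unfolding sum_of_submodules_def by blast
      define f' where "f' A = (if A \<in> F then f A else 0) + (if A = S then s else 0)" for A
      have "sum f' (insert S F) = x"
        using f(1,2) x(1) by (simp add: f'_def sum.distrib sum.If_cases Int_absorb1 subset_insertI)
      moreover have "f' A \<in> A" if "A \<in> insert S F" for A
      proof -
        have "left_ideal A" using that f(3) add.hyps(2) min minimal_left_idealD(1) by blast
        then show ?thesis using that f(4) x(3) by (auto simp: f'_def left_idealD)
      qed
      ultimately show "x \<in> sum_of_submodules \<S>"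
        unfolding sum_of_submodules_def using f(2,3) add.hyps(2)
        by (intro CollectI exI[of _ f'] exI[of _ "insert S F"]) auto
    qed
  qed
qed

text \<open>The chain condition lets finitely many finite minimal left ideals exhaust the whole sum;
  \<open>finite_finite_sum\<close> then makes the socle a finite set.\<close>

lemma finitary_left_socle_finite_sum:
  assumes art: "left_artinian TYPE('r::{ring,monoid_mult})"
  shows "finite_sum {I. minimal_left_ideal I \<and> finite I} (finitary_left_socle :: 'r set)"
    and "\<And>S :: 'r set. minimal_left_ideal S \<Longrightarrow> finite S \<Longrightarrow> S \<subseteq> finitary_left_socle"
proof -
  let ?\<S> = "{I :: 'r set. minimal_left_ideal I \<and> finite I}"
  have min: "?\<S> \<subseteq> Collect minimal_left_ideal" by blast
  obtain B where B: "finite_sum ?\<S> B" "\<And>S. S \<in> ?\<S> \<Longrightarrow> S \<subseteq> B"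
    using artinian_finite_sum[OF art min] by blast
  have eq: "finitary_left_socle = B"
    unfolding finitary_left_socle_def using sum_of_submodules_finite_sum[OF B(1) min B(2)] .
  show "finite_sum ?\<S> finitary_left_socle" unfolding eq by fact
  show "S \<subseteq> finitary_left_socle" if "minimal_left_ideal S" "finite S" for S :: "'r set"
    unfolding eq using B(2) that by blast
qed

text \<open>A left ideal \<open>K'\<close> that is minimal with \<open>K + K' = R\<close> meets \<open>K\<close> inside every maximal left ideal.\<close>

lemma complement_modulo_radical:
  assumes art: "left_artinian TYPE('r::{ring,monoid_mult})"
    and K: "left_ideal (K :: 'r set)" "jacobson_radical \<subseteq> K"
  obtains K' where "left_ideal K'" "K + K' = UNIV" "K \<inter> K' = jacobson_radical"
proof -
  let ?P = "\<lambda>L. left_ideal L \<and> jacobson_radical \<subseteq> L \<and> K + L = UNIV"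
  have "K + UNIV = UNIV" using subset_plus_right[OF K(1), of UNIV] by blast
  then have "?P UNIV" using left_ideal_UNIV by blast
  then obtain K' where K': "?P K'" and min: "\<And>L. ?P L \<Longrightarrow> L \<subseteq> K' \<Longrightarrow> L = K'"
    using artinian_minimal[OF art, of ?P UNIV] by blast
  have ideal: "left_ideal K'" using K' by blast
  have "K \<inter> K' \<subseteq> m" if m: "maximal_left_ideal m" for m
  proof (rule ccontr)
    assume not_sub: "\<not> K \<inter> K' \<subseteq> m"
    have m': "left_ideal m" using m by (simp add: maximal_left_ideal_def)
    have KK': "left_ideal (K \<inter> K')" using left_ideal_inter[OF K(1) ideal] .
    have "K \<inter> K' \<subseteq> m + K \<inter> K'" using subset_plus_right[OF m'] .
    then have "m + K \<inter> K' \<noteq> m" using not_sub by blast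
    moreover have "m \<subseteq> m + K \<inter> K'" using subset_plus_left[OF KK'] .
    ultimately have UNIV: "m + K \<inter> K' = UNIV"
      using m left_ideal_plus[OF m' KK'] unfolding maximal_left_ideal_def by blast
    \<comment> \<open>The left ideal \<open>K' \<inter> m\<close> still has the whole ring as its
      sum with \<open>K\<close>, by the modular law; minimality of \<open>K'\<close> then puts
      \<open>K'\<close> inside \<open>m\<close>, against the choice of \<open>m\<close>.\<close>
    have ideal_Km: "left_ideal (K' \<inter> m)" using left_ideal_inter[OF ideal m'] .
    have sum: "left_ideal (K + K' \<inter> m)" using left_ideal_plus[OF K(1) ideal_Km] .
    have "K' \<subseteq> K + K' \<inter> m"
    proof
      fix k assume k: "k \<in> K'"
      obtain a y where ay: "k = a + y" "a \<in> m" "y \<in> K \<inter> K'"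
        using UNIV by (metis UNIV_I set_plus_elim)
      then have "a = k - y" by simp
      then have "a \<in> K' \<inter> m" using left_idealD(5)[OF ideal k] ay by blast
      then have "y + a \<in> K + K' \<inter> m" using ay(3) by blast
      then show "k \<in> K + K' \<inter> m" using ay(1) by (simp add: add.commute)
    qed
    then have "K + K' \<subseteq> K + K' \<inter> m"
      using plus_subset[OF sum subset_plus_left[OF ideal_Km]] by blast
    then have "K + K' \<inter> m = UNIV" using K' by blast
    moreover have "jacobson_radical \<subseteq> K' \<inter> m"
      using K' m by (auto simp: jacobson_radical_def)
    ultimately have "K' \<inter> m = K'" using min ideal_Km by blast
    then show False using not_sub by blast
  qed
  then have "K \<inter> K' \<subseteq> jacobson_radical" by (auto simp: jacobson_radical_def)
  then show thesis using that[of K'] K' K(2) by blast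
qed

text \<open>For nonzero \<open>x\<close> in \<open>S\<close> the annihilator of \<open>x\<close> is
  a maximal left ideal, because the quotient by it is isomorphic to \<open>R x = S\<close>, which is
  simple.\<close>

lemma radical_annihilates_minimal:
  assumes S: "minimal_left_ideal S" and j: "j \<in> jacobson_radical" and x: "x \<in> S"
  shows "j * x = 0"
proof (cases "x = 0")
  case False
  have S': "left_ideal S" using minimal_left_idealD(1)[OF S] .
  have "maximal_left_ideal {r. r * x = 0}"
    unfolding maximal_left_ideal_def
  proof (intro conjI allI impI)
    show "left_ideal {r. r * x = 0}" by (rule left_ideal_annihilator)
    have "1 \<notin> {r. r * x = 0}" using False by simp
    then show "{r. r * x = 0} \<noteq> UNIV" by blast
    fix K assume K: "left_ideal K \<and> {r. r * x = 0} \<subseteq> K"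
    then have ideal: "left_ideal K" ..
    have "(\<lambda>k. k * x) ` K \<subseteq> S" using left_idealD(3)[OF S' x] by blast
    then consider "(\<lambda>k. k * x) ` K = {0}" | "(\<lambda>k. k * x) ` K = S"
      using minimal_left_idealD(3)[OF S left_ideal_image_mult[OF ideal]] by blast
    then show "K = {r. r * x = 0} \<or> K = UNIV"
    proof cases
      case 1
      then show ?thesis using K by blast
    next
      case 2
      then obtain k where k: "k \<in> K" "k * x = x" using x by (metis imageE)
      then have "(1 - k) * x = 0" by (simp add: left_diff_distrib)
      then have "1 - k \<in> K" using K by blast
      then have "(1 - k) + k \<in> K" using left_idealD(2)[OF ideal _ k(1)] by blast
      then have "1 \<in> K" by simp
      then have "r \<in> K" for r using left_idealD(3)[OF ideal, of 1 r] by simp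
      then show ?thesis by blast
    qed
  qed
  then show ?thesis using j by (auto simp: jacobson_radical_def)
qed simp

lemma radical_annihilates_finite_sum:
  assumes "finite_sum \<S> B" "\<S> \<subseteq> Collect minimal_left_ideal" and j: "j \<in> jacobson_radical" and "x \<in> B"
  shows "j * x = 0"
  using assms(1,4)
proof (induction arbitrary: x rule: finite_sum.induct)
  case (add B S)
  then obtain b s where "x = b + s" "b \<in> B" "s \<in> S" by (auto elim: set_plus_elim)
  then show ?case
    using add.IH[of b] radical_annihilates_minimal[OF _ j, of S s] add.hyps(2) assms(2)
    by (auto simp: distrib_left)
qed simp

lemma abs_rad_quot_eq_iff: "abs_rad_quot x = abs_rad_quot y \<longleftrightarrow> x - y \<in> jacobson_radical"
  by (simp add: rad_quot.abs_eq_iff rad_rel_def)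

text \<open>Let \<open>K\<close> be the preimage in the ring of the image of \<open>A\<close>, and
  split \<open>1 = k + k'\<close> along a complement of \<open>K\<close> modulo the radical. Then
  \<open>r k\<close> and \<open>r\<close> agree modulo the radical for every \<open>r\<close> in
  \<open>K\<close>, so the class of \<open>k\<close> generates the image, and its preimage
  \<open>a\<close> generates \<open>A\<close>.\<close>

lemma embeds_imp_principal:
  assumes art: "left_artinian TYPE('r::{ring,monoid_mult})"
    and A: "left_ideal (A :: 'r set)"
    and emb: "embeds (*) A rad_quot_scale (UNIV :: 'r rad_quot set)"
  obtains a where "A = range (\<lambda>r. r * a)"
proof -
  obtain f where f: "left_hom (*) A rad_quot_scale (UNIV :: 'r rad_quot set) f" "inj_on f A"
    using emb by (auto simp: embeds_def)
  note fD = left_homD[OF left_module_mult left_module_rad_quot A f(1)]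
  have f_scale: "f (r * x) = rad_quot_scale r (f x)" if "x \<in> A" for r x
    using f(1) that by (simp add: left_hom_def)
  define K where "K = {r. abs_rad_quot r \<in> f ` A}"
  define F where "F = f ` A"
  have "submodule rad_quot_scale F" unfolding F_def by (rule fD(4))
  then have K: "left_ideal K"
    unfolding K_def F_def[symmetric] submodule_def zero_rad_quot_def
    by (simp add: plus_rad_quot.abs_eq[symmetric] rad_quot_scale.abs_eq[symmetric])
  have "jacobson_radical \<subseteq> K"
  proof
    fix j :: 'r assume "j \<in> jacobson_radical"
    then have "abs_rad_quot j = 0" by (simp add: zero_rad_quot_def abs_rad_quot_eq_iff)
    moreover have "0 \<in> f ` A" using fD(1) left_idealD(1)[OF A] by (metis image_eqI)
    ultimately show "j \<in> K" by (simp add: K_def)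
  qed
  then obtain K' where K': "left_ideal K'" "K + K' = UNIV" "K \<inter> K' = jacobson_radical"
    using complement_modulo_radical[OF art K] by blast
  obtain k k' where kk': "1 = k + k'" "k \<in> K" "k' \<in> K'" using K'(2) by (metis UNIV_I set_plus_elim)
  obtain a where a: "a \<in> A" "abs_rad_quot k = f a" using kk'(2) by (auto simp: K_def)
  have "\<exists>r. x = r * a" if x: "x \<in> A" for x
  proof -
    obtain r where r: "f x = abs_rad_quot r" using Quotient_abs_rep[OF Quotient_rad_quot] by metis
    then have "r \<in> K" unfolding K_def using imageI[OF x, of f] by simp
    moreover have "r * k' = r - r * k" using kk'(1) by (metis add_diff_cancel_left' distrib_left mult_1_right)
    ultimately have "r - r * k \<in> K \<inter> K'"
      using left_idealD(3,5)[OF K] left_idealD(3)[OF K'(1) kk'(3), of r] kk'(2) by auto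
    then have "f x = abs_rad_quot (r * k)" using r K'(3) by (simp add: abs_rad_quot_eq_iff)
    also have "\<dots> = f (r * a)" using a f_scale by (simp add: rad_quot_scale.abs_eq[symmetric])
    finally have "x = r * a" using f(2) x left_idealD(3)[OF A a(1)] by (simp add: inj_on_eq_iff)
    then show ?thesis ..
  qed
  then have "A = range (\<lambda>r. r * a)" using left_idealD(3)[OF A a(1)] by blast
  with that show thesis .
qed

text \<open>Modulo the radical, the annihilator of \<open>a\<close> has a complement
  \<open>K\<close>. Every element of \<open>R a\<close> is \<open>k a\<close> with \<open>k\<close>
  in \<open>K\<close>, and \<open>k\<close> is unique modulo the radical, so sending
  \<open>k a\<close> to the class of \<open>k\<close> is well defined; it is injective because the
  radical annihilates \<open>a\<close>.\<close>

lemma principal_imp_embeds: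
  assumes art: "left_artinian TYPE('r::{ring,monoid_mult})"
    and ann: "\<And>j. j \<in> jacobson_radical \<Longrightarrow> j * a = (0 :: 'r)"
  shows "embeds (*) (range (\<lambda>r. r * a)) rad_quot_scale (UNIV :: 'r rad_quot set)"
proof -
  let ?L = "{r. r * a = 0}"
  have "jacobson_radical \<subseteq> ?L" using ann by blast
  then obtain K where K: "left_ideal K" "?L + K = UNIV" "?L \<inter> K = jacobson_radical"
    using complement_modulo_radical[OF art left_ideal_annihilator] by blast
  define f where "f x = abs_rad_quot (SOME k. k \<in> K \<and> x = k * a)" for x
  have f: "f (k * a) = abs_rad_quot k" if k: "k \<in> K" for k
  proof -
    define k' where "k' = (SOME k'. k' \<in> K \<and> k * a = k' * a)"
    have k': "k' \<in> K \<and> k * a = k' * a" unfolding k'_def by (rule someI[of _ k]) (simp add: k)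
    then have "k' - k \<in> ?L \<inter> K" using left_idealD(5)[OF K(1)] k by (simp add: left_diff_distrib)
    then show ?thesis unfolding f_def k'_def[symmetric] K(3) by (simp add: abs_rad_quot_eq_iff)
  qed
  have surj: "\<exists>k\<in>K. x = k * a" if x: "x \<in> range (\<lambda>r. r * a)" for x
  proof -
    obtain r where r: "x = r * a" using x by blast
    obtain l k where "r = l + k" "l \<in> ?L" "k \<in> K" using K(2) by (metis UNIV_I set_plus_elim)
    then have "x = k * a" using r by (simp add: distrib_right)
    then show ?thesis using \<open>k \<in> K\<close> by blast
  qed
  have "left_hom (*) (range (\<lambda>r. r * a)) rad_quot_scale (UNIV :: 'r rad_quot set) f"
    unfolding left_hom_def
  proof (intro conjI ballI allI)
    fix x y assume "x \<in> range (\<lambda>r. r * a)" "y \<in> range (\<lambda>r. r * a)"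
    then obtain k l where kl: "x = k * a" "k \<in> K" "y = l * a" "l \<in> K" using surj by metis
    then show "f (x + y) = f x + f y"
      using f[of "k + l"] left_idealD(2)[OF K(1) kl(2,4)] by (simp add: f distrib_right plus_rad_quot.abs_eq)
  next
    fix r x assume "x \<in> range (\<lambda>r. r * a)"
    then obtain k where k: "x = k * a" "k \<in> K" using surj by metis
    then show "f (r * x) = rad_quot_scale r (f x)"
      using f[of "r * k"] left_idealD(3)[OF K(1) k(2), of r] by (simp add: f mult.assoc rad_quot_scale.abs_eq)
  qed simp
  moreover have "inj_on f (range (\<lambda>r. r * a))"
  proof (rule inj_onI)
    fix x y assume xy: "x \<in> range (\<lambda>r. r * a)" "y \<in> range (\<lambda>r. r * a)" "f x = f y"
    then obtain k l where kl: "x = k * a" "k \<in> K" "y = l * a" "l \<in> K" using surj by metis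
    then have "k - l \<in> jacobson_radical" using f xy(3) by (simp add: abs_rad_quot_eq_iff)
    then have "k - l \<in> ?L" using K(3) by blast
    then show "x = y" using kl by (simp add: left_diff_distrib)
  qed
  ultimately show ?thesis by (auto simp: embeds_def)
qed

section \<open>Relations between kernels\<close>

text \<open>The set \<open>A\<close> will be the finitary left socle. Faithfulness is asked of all
  finite left ideals, since images of kernels need not lie in \<open>A\<close>, but the witness must
  lie in \<open>A\<close>, where \<open>\<chi>\<close> is a character.\<close>

locale faithful_socle_character =
  fixes A :: "'r::{ring,monoid_mult} set" and \<chi> :: "'r \<Rightarrow> complex"
  assumes A: "left_ideal A" "finite A" and \<chi>: "\<chi> \<in> characters A"
    and faithful: "left_ideal K \<Longrightarrow> K \<noteq> {0} \<Longrightarrow> finite K \<Longrightarrow> \<exists>a\<in>K. a \<in> A \<and> \<chi> a \<noteq> 1"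
begin

text \<open>Up to conjugation of \<open>\<chi>\<close> and scaling, the sum is a Fourier coefficient
  of \<open>g\<close> on the coset of \<open>A\<close> through \<open>x\<^sub>0\<close>. Unlike the
  mere existence of a nonzero value, its nonvanishing survives suitable difference
  operators.\<close>

definition detected :: "('r \<Rightarrow> complex) \<Rightarrow> bool" where
  "detected g \<longleftrightarrow> finite {x. g x \<noteq> 0} \<and> (\<exists>x\<^sub>0. (\<Sum>y\<in>A. g (x\<^sub>0 + y) * \<chi> y) \<noteq> 0)"

lemma detected_nonzero: "detected g \<Longrightarrow> \<exists>x. g x \<noteq> 0"
  unfolding detected_def by (rule ccontr) simp

lemma finite_support_difference:
  fixes g :: "'a::ab_group_add \<Rightarrow> complex"
  assumes "finite {x. g x \<noteq> 0}"
  shows "finite {x. g x - g (x + a) \<noteq> 0}"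
proof -
  have "{x. g x - g (x + a) \<noteq> 0} \<subseteq> {x. g x \<noteq> 0} \<union> (\<lambda>x. x - a) ` {x. g x \<noteq> 0}"
  proof
    fix x assume x: "x \<in> {x. g x - g (x + a) \<noteq> 0}"
    show "x \<in> {x. g x \<noteq> 0} \<union> (\<lambda>x. x - a) ` {x. g x \<noteq> 0}"
    proof (cases "g x = 0")
      case True
      then have "g (x + a) \<noteq> 0" using x by simp
      then show ?thesis by (intro UnI2 image_eqI[of _ _ "x + a"]) auto
    qed simp
  qed
  then show ?thesis using assms finite_subset by blast
qed

text \<open>On a coset of \<open>A\<close>, the difference operator of \<open>a \<in> A\<close> multiplies the sum at \<open>\<chi>\<close> by
  \<open>1 - \<chi> (- a)\<close>. If the left ideal \<open>K\<close> is infinite, then \<open>a \<in> K\<close> can be chosen to move the coset off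
  the support of \<open>g\<close>, which leaves the sum unchanged.\<close>

lemma detected_difference:
  assumes g: "detected g" and K: "left_ideal K" "K \<noteq> {0}"
  obtains a where "a \<in> K" "detected (\<lambda>x. g x - g (x + a))"
proof -
  obtain x0 where x0: "(\<Sum>y\<in>A. g (x0 + y) * \<chi> y) \<noteq> 0" and fin: "finite {x. g x \<noteq> 0}"
    using g by (auto simp: detected_def)
  show thesis
  proof (cases "finite K")
    case True
    then obtain a where a: "a \<in> K" "a \<in> A" "\<chi> a \<noteq> 1" using faithful K by blast
    note minus = character_minus[OF \<chi> A(2) left_ideal_add_closed[OF A(1)] a(2)]
    have "(\<Sum>y\<in>A. g (x0 + y + a) * \<chi> y) = (\<Sum>y\<in>A. g (x0 + y) * \<chi> (y - a))"
    proof (rule sum.reindex_bij_witness[of _ "\<lambda>y. y - a" "\<lambda>y. y + a"])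
      fix y assume "y \<in> A"
      then show "y + a \<in> A" "y - a \<in> A" using a(2) left_idealD[OF A(1)] by auto
    qed (simp_all add: add.assoc)
    also have "\<dots> = (\<Sum>y\<in>A. \<chi> (- a) * (g (x0 + y) * \<chi> y))"
    proof (rule sum.cong)
      fix y assume "y \<in> A"
      then have "\<chi> (y + (- a)) = \<chi> y * \<chi> (- a)"
        using \<chi> left_idealD(4)[OF A(1) a(2)] unfolding characters_def by blast
      then show "g (x0 + y) * \<chi> (y - a) = \<chi> (- a) * (g (x0 + y) * \<chi> y)" by simp
    qed simp
    also have "\<dots> = \<chi> (- a) * (\<Sum>y\<in>A. g (x0 + y) * \<chi> y)" by (simp add: sum_distrib_left)
    finally have "(\<Sum>y\<in>A. (g (x0 + y) - g (x0 + y + a)) * \<chi> y)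
      = (1 - \<chi> (- a)) * (\<Sum>y\<in>A. g (x0 + y) * \<chi> y)"
      by (simp add: left_diff_distrib sum_subtractf)
    moreover have "\<chi> (- a) \<noteq> 1" using minus a(3) by auto
    ultimately have "(\<Sum>y\<in>A. (g (x0 + y) - g (x0 + y + a)) * \<chi> y) \<noteq> 0" using x0 by simp
    then show thesis
      using that[OF a(1)] finite_support_difference[OF fin, of a] unfolding detected_def by blast
  next
    case False
    \<comment> \<open>The shifts that carry some point of the coset onto the support; they are
      finitely many, so an infinite \<open>K\<close> has an element outside
      \<open>E\<close>.\<close>
    define E where "E = (\<Union>y\<in>A. (\<lambda>z. z - x0 - y) ` {x. g x \<noteq> 0})"
    have "finite E" unfolding E_def using A(2) fin by blast
    then obtain a where a: "a \<in> K" "a \<notin> E" using False by (meson finite_subset subsetI)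
    have "g (x0 + y + a) = 0" if y: "y \<in> A" for y
    proof (rule ccontr)
      assume "g (x0 + y + a) \<noteq> 0"
      then have "(x0 + y + a) - x0 - y \<in> E" unfolding E_def using y by blast
      then show False using a(2) by (simp add: algebra_simps)
    qed
    then have "(\<Sum>y\<in>A. (g (x0 + y) - g (x0 + y + a)) * \<chi> y) \<noteq> 0" using x0 by simp
    then show thesis
      using that[OF a(1)] finite_support_difference[OF fin, of a] unfolding detected_def by blast
  qed
qed

text \<open>The difference operator of \<open>v \<in> V j\<close> removes the summand \<open>h j\<close> while keeping \<open>g\<close> detected.\<close>

lemma no_periodic_relation:
  assumes "finite J" and M: "left_module scale" "submodule scale M"
    and l: "left_hom scale M (*) UNIV l"
    and V: "\<And>j. j \<in> J \<Longrightarrow> submodule scale (V j) \<and> V j \<subseteq> M \<and> l ` V j \<noteq> {0}"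
    and "\<And>j x v. j \<in> J \<Longrightarrow> x \<in> M \<Longrightarrow> v \<in> V j \<Longrightarrow> h j (x + v) = h j x"
    and "detected g" "\<And>y. y \<notin> l ` M \<Longrightarrow> g y = 0"
    and "\<And>x. x \<in> M \<Longrightarrow> g (l x) + (\<Sum>j\<in>J. h j x) = 0"
  shows False
  using assms(1,5-)
proof (induction arbitrary: g h rule: finite_induct)
  case empty
  \<comment> \<open>With no summand left, \<open>g\<close> vanishes on the image of
    \<open>l\<close>; the support condition extends this to the whole ring, against
    \<open>detected\<close>.\<close>
  obtain y where y: "g y \<noteq> 0" using detected_nonzero[OF empty(3)] by blast
  then have "y \<in> l ` M" using empty(4) by blast
  then show False using empty(5) y by auto
next
  case (insert i J)
  have i: "submodule scale (V i)" "V i \<subseteq> M" "l ` V i \<noteq> {0}" using insert.prems(1)[of i] by auto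
  have l': "left_hom scale (V i) (*) UNIV l" using left_hom_mono[OF l i(2) subset_refl] .
  obtain a where a: "a \<in> l ` V i" "detected (\<lambda>x. g x - g (x + a))"
    using detected_difference[OF insert.prems(3) left_homD(4)[OF M(1) left_module_mult i(1) l'] i(3)]
    by blast
  then obtain v where v: "v \<in> V i" "a = l v" by blast
  have vM: "v \<in> M" using v(1) i(2) by blast
  have closed: "x + v \<in> M" if "x \<in> M" for x using that vM M(2) by (simp add: submodule_def)
  have l_add: "l (x + v) = l x + a" if "x \<in> M" for x using l that vM v(2) by (simp add: left_hom_def)
  show False
  proof (rule insert.IH[of "\<lambda>j x. h j x - h j (x + v)" "\<lambda>x. g x - g (x + a)"])
    show "submodule scale (V j) \<and> V j \<subseteq> M \<and> l ` V j \<noteq> {0}" if "j \<in> J" for j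
      using insert.prems(1) that by blast
    show "h j (x + w) - h j (x + w + v) = h j x - h j (x + v)" if "j \<in> J" "x \<in> M" "w \<in> V j" for j x w
    proof -
      have "h j (x + v + w) = h j (x + v)" "h j (x + w) = h j x"
        using insert.prems(2)[of j] that closed by auto
      then show ?thesis by (simp add: add.assoc add.commute[of v w])
    qed
    show "detected (\<lambda>x. g x - g (x + a))" by fact
    show "g y - g (y + a) = 0" if y: "y \<notin> l ` M" for y
    proof -
      have "y + a \<notin> l ` M"
      proof
        assume "y + a \<in> l ` M"
        then obtain x where x: "x \<in> M" "y + a = l x" by blast
        have "l (x - v) = l x - l v" using left_homD(2)[OF M(1) left_module_mult M(2) l x(1) vM] .
        then have "y = l (x - v)" unfolding x(2)[symmetric] v(2) by simp
        then show False using y left_module.submodule_diff[OF M x(1) vM] by blast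
      qed
      then show ?thesis using insert.prems(4) y by simp
    qed
    fix x assume x: "x \<in> M"
    have "h i (x + v) = h i x" using insert.prems(2)[of i] x v(1) by blast
    then have "g (l x) + (h i x + (\<Sum>j\<in>J. h j x)) = 0"
      "g (l x + a) + (h i x + (\<Sum>j\<in>J. h j (x + v))) = 0"
      using insert.prems(5)[OF x] insert.prems(5)[OF closed[OF x]] insert.hyps l_add[OF x] by simp_all
    then show "g (l x) - g (l x + a) + (\<Sum>j\<in>J. h j x - h j (x + v)) = 0"
      by (simp add: sum_subtractf eq_neg_iff_add_eq_0 add_eq_0_iff)
  qed
qed

text \<open>The members of \<open>K\<close> with the minimal kernel combine to \<open>e\<close>
  times the indicator of 0 composed with \<open>\<mu> k\<^sub>0\<close>. If \<open>e\<close> is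
  nonzero, this multiple of the indicator is detected. By minimality any other kernel is not
  contained in that of \<open>k\<^sub>0\<close>, so it has nonzero image under
  \<open>\<mu> k\<^sub>0\<close>, as \<open>no_periodic_relation\<close> demands.\<close>

lemma kernel_relation:
  fixes \<mu> :: "'k \<Rightarrow> 'm::ab_group_add \<Rightarrow> 'r" and \<epsilon> :: "'k \<Rightarrow> complex"
  assumes K: "finite K" "k\<^sub>0 \<in> K" and M: "left_module scale" "submodule scale M"
    and \<mu>: "\<And>k. k \<in> K \<Longrightarrow> left_hom scale M (*) UNIV (\<mu> k)"
    and min: "\<And>k. k \<in> K \<Longrightarrow> {x\<in>M. \<mu> k x = 0} \<subseteq> {x\<in>M. \<mu> k\<^sub>0 x = 0} \<Longrightarrow> {x\<in>M. \<mu> k x = 0} = {x\<in>M. \<mu> k\<^sub>0 x = 0}"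
    and rel: "\<And>x. x \<in> M \<Longrightarrow> (\<Sum>k\<in>K. if \<mu> k x = 0 then \<epsilon> k else 0) = 0"
  shows "(\<Sum>k | k \<in> K \<and> {x\<in>M. \<mu> k x = 0} = {x\<in>M. \<mu> k\<^sub>0 x = 0}. \<epsilon> k) = 0"
proof (rule ccontr)
  define V where "V k = {x\<in>M. \<mu> k x = 0}" for k
  define J where "J = {k\<in>K. V k \<noteq> V k\<^sub>0}"
  define K0 where "K0 = {k\<in>K. V k = V k\<^sub>0}"
  define e where "e = (\<Sum>k\<in>K0. \<epsilon> k)"
  assume "(\<Sum>k | k \<in> K \<and> {x\<in>M. \<mu> k x = 0} = {x\<in>M. \<mu> k\<^sub>0 x = 0}. \<epsilon> k) \<noteq> 0"
  then have e: "e \<noteq> 0" by (simp add: e_def K0_def V_def)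
  define g where "g y = (if y = 0 then e else 0)" for y :: 'r
  define h where "h k x = (if \<mu> k x = 0 then \<epsilon> k else 0)" for k x
  note homD = left_homD[OF M(1) left_module_mult M(2) \<mu>]
  have \<mu>0: "\<mu> k 0 = 0" if "k \<in> K" for k using homD(1)[OF that] .
  have add: "\<mu> k (x + y) = \<mu> k x + \<mu> k y" and mult: "\<mu> k (scale r x) = r * \<mu> k x"
    if "k \<in> K" "x \<in> M" "y \<in> M" for k x y r
    using \<mu>[OF that(1)] that(2,3) by (simp_all add: left_hom_def)
  show False
  proof (rule no_periodic_relation[OF _ M \<mu>[OF K(2)], of J V h g])
    show "finite J" using K(1) by (simp add: J_def)
    show "submodule scale (V j) \<and> V j \<subseteq> M \<and> \<mu> k\<^sub>0 ` V j \<noteq> {0}" if "j \<in> J" for j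
    proof (intro conjI)
      have j: "j \<in> K" "V j \<noteq> V k\<^sub>0" using that by (auto simp: J_def)
      show "submodule scale (V j)"
        using M(2) \<mu>0[OF j(1)] add[OF j(1)] mult[OF j(1)] by (auto simp: V_def submodule_def)
      show "V j \<subseteq> M" by (auto simp: V_def)
      obtain x where "x \<in> V j" "x \<notin> V k\<^sub>0" using min[OF j(1)] j(2) unfolding V_def by blast
      then show "\<mu> k\<^sub>0 ` V j \<noteq> {0}" by (auto simp: V_def)
    qed
    show "h j (x + v) = h j x" if "j \<in> J" "x \<in> M" "v \<in> V j" for j x v
      using that add[of j x v] by (simp add: h_def V_def J_def)
    have "(\<Sum>y\<in>A. g (0 + y) * \<chi> y) = (\<Sum>y\<in>A. if y = 0 then e * \<chi> y else 0)"
      by (rule sum.cong) (auto simp: g_def)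
    also have "\<dots> = e"
      using left_idealD(1)[OF A(1)] A(2) \<chi> by (simp add: sum.delta characters_def)
    finally show "detected g"
      unfolding detected_def using e by (auto simp: g_def intro!: exI[of _ 0])
    show "g y = 0" if "y \<notin> \<mu> k\<^sub>0 ` M" for y
    proof -
      have "0 \<in> \<mu> k\<^sub>0 ` M" using \<mu>0[OF K(2)] M(2) by (metis image_eqI submodule_def)
      then show ?thesis using that by (auto simp: g_def)
    qed
    fix x assume x: "x \<in> M"
    have "(\<Sum>k\<in>K0. h k x) = (\<Sum>k\<in>K0. if \<mu> k\<^sub>0 x = 0 then \<epsilon> k else 0)"
    proof (rule sum.cong)
      fix k assume "k \<in> K0"
      then have "x \<in> V k \<longleftrightarrow> x \<in> V k\<^sub>0" by (simp add: K0_def)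
      then show "h k x = (if \<mu> k\<^sub>0 x = 0 then \<epsilon> k else 0)" using x by (simp add: h_def V_def)
    qed simp
    also have "\<dots> = g (\<mu> k\<^sub>0 x)" by (simp add: g_def e_def)
    finally have "g (\<mu> k\<^sub>0 x) + (\<Sum>k\<in>J. h k x) = (\<Sum>k\<in>K0 \<union> J. h k x)"
      using K(1) by (subst sum.union_disjoint) (auto simp: K0_def J_def)
    also have "K0 \<union> J = K" by (auto simp: K0_def J_def)
    finally show "g (\<mu> k\<^sub>0 x) + (\<Sum>k\<in>J. h k x) = 0" using rel[OF x] by (simp add: h_def)
  qed
qed

end

section \<open>The extension property\<close>

text \<open>Equal counts of zeros give a relation with coefficient 1 on \<open>I\<close> and -1 on
  \<open>J\<close>. For a kernel that is minimal among all of them the coefficients cancel, so it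
  occurs equally often in both families and therefore in each.\<close>

lemma (in faithful_socle_character) common_kernel:
  fixes \<pi> :: "'i \<Rightarrow> 'm::ab_group_add \<Rightarrow> 'r" and \<rho> :: "'j \<Rightarrow> 'm \<Rightarrow> 'r"
  assumes fin: "finite I" "finite J" and ne: "I \<noteq> {}"
    and M: "left_module scale" "submodule scale M"
    and \<pi>: "\<And>i. i \<in> I \<Longrightarrow> left_hom scale M (*) UNIV (\<pi> i)"
    and \<rho>: "\<And>j. j \<in> J \<Longrightarrow> left_hom scale M (*) UNIV (\<rho> j)"
    and zeros: "\<And>x. x \<in> M \<Longrightarrow> card {i\<in>I. \<pi> i x = 0} = card {j\<in>J. \<rho> j x = 0}"
  obtains i j where "i \<in> I" "j \<in> J" "\<And>x. x \<in> M \<Longrightarrow> \<pi> i x = 0 \<longleftrightarrow> \<rho> j x = 0"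
proof -
  define \<mu> where "\<mu> = case_sum \<pi> \<rho>"
  define \<epsilon> :: "'i + 'j \<Rightarrow> complex" where "\<epsilon> = case_sum (\<lambda>_. 1) (\<lambda>_. - 1)"
  define V where "V k = {x\<in>M. \<mu> k x = 0}" for k
  have fin_K: "finite (I <+> J)" using fin by simp
  have "finite (V ` (I <+> J))" "V ` (I <+> J) \<noteq> {}" using fin_K ne by auto
  then have "\<exists>W\<in>V ` (I <+> J). \<forall>W'\<in>V ` (I <+> J). W' \<subseteq> W \<longrightarrow> W = W'" by (rule finite_has_minimal)
  then obtain W where W: "W \<in> V ` (I <+> J)" "\<forall>W'\<in>V ` (I <+> J). W' \<subseteq> W \<longrightarrow> W = W'" by (rule bexE)
  obtain k0 where k0: "k0 \<in> I <+> J" "W = V k0" using W(1) by (rule imageE)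
  have V_min: "V k = V k0" if "k \<in> I <+> J" "V k \<subseteq> V k0" for k
    using W(2)[rule_format, OF imageI[OF that(1)]] that(2) unfolding k0(2) by simp
  have "(\<Sum>k | k \<in> I <+> J \<and> V k = V k0. \<epsilon> k) = 0"
    unfolding V_def
  proof (rule kernel_relation[OF fin_K k0(1) M])
    show "left_hom scale M (*) UNIV (\<mu> k)" if "k \<in> I <+> J" for k
      using that \<pi> \<rho> by (auto simp: \<mu>_def)
    show "{x \<in> M. \<mu> k x = 0} = {x \<in> M. \<mu> k0 x = 0}"
      if "k \<in> I <+> J" "{x \<in> M. \<mu> k x = 0} \<subseteq> {x \<in> M. \<mu> k0 x = 0}" for k
      using V_min[of k] that unfolding V_def by blast
    fix x assume x: "x \<in> M"
    have "(\<Sum>k\<in>I <+> J. if \<mu> k x = 0 then \<epsilon> k else 0)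
      = (\<Sum>i\<in>I. if \<pi> i x = 0 then 1 else 0) + (\<Sum>j\<in>J. if \<rho> j x = 0 then - 1 else 0)"
      using fin by (simp add: sum.Plus \<mu>_def \<epsilon>_def cong: if_cong)
    also have "\<dots> = of_nat (card {i\<in>I. \<pi> i x = 0}) - of_nat (card {j\<in>J. \<rho> j x = 0})"
      using fin by (simp add: sum.If_cases Int_def conj_commute)
    finally show "(\<Sum>k\<in>I <+> J. if \<mu> k x = 0 then \<epsilon> k else 0) = 0" using zeros[OF x] by simp
  qed
  moreover have "{k. k \<in> I <+> J \<and> V k = V k0} = {i\<in>I. V (Inl i) = V k0} <+> {j\<in>J. V (Inr j) = V k0}"
    by auto
  ultimately have "of_nat (card {i\<in>I. V (Inl i) = V k0}) = (of_nat (card {j\<in>J. V (Inr j) = V k0}) :: complex)"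
    using fin by (simp add: sum.Plus \<epsilon>_def)
  then have card: "card {i\<in>I. V (Inl i) = V k0} = card {j\<in>J. V (Inr j) = V k0}" by simp
  have "{i\<in>I. V (Inl i) = V k0} \<noteq> {} \<or> {j\<in>J. V (Inr j) = V k0} \<noteq> {}" using k0(1) by auto
  moreover have "finite {i\<in>I. V (Inl i) = V k0}" "finite {j\<in>J. V (Inr j) = V k0}" using fin by simp_all
  ultimately have "{i\<in>I. V (Inl i) = V k0} \<noteq> {}" "{j\<in>J. V (Inr j) = V k0} \<noteq> {}"
    using card by (metis card_0_eq)+
  then obtain i j where ij: "i \<in> I" "j \<in> J" "V (Inl i) = V k0" "V (Inr j) = V k0" by blast
  then have "\<pi> i x = 0 \<longleftrightarrow> \<rho> j x = 0" if "x \<in> M" for x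
    using that by (auto simp: V_def \<mu>_def)
  then show thesis using that ij by blast
qed

section \<open>Comparison of homomorphisms with equal kernels\<close>

lemma hom_factor:
  assumes mod: "left_module scale" "left_module scale\<^sub>1" "left_module scale\<^sub>2"
    and M: "submodule scale M"
    and l: "left_hom scale M scale\<^sub>1 L l" and r: "left_hom scale M scale\<^sub>2 N r"
    and ker: "\<And>x. x \<in> M \<Longrightarrow> l x = 0 \<Longrightarrow> r x = 0"
  obtains f where "left_hom scale\<^sub>1 (l ` M) scale\<^sub>2 (r ` M) f" "\<And>x. x \<in> M \<Longrightarrow> f (l x) = r x"
proof
  define f where "f y = r (SOME x. x \<in> M \<and> l x = y)" for y
  show f: "f (l x) = r x" if x: "x \<in> M" for x
  proof -
    define x' where "x' = (SOME x'. x' \<in> M \<and> l x' = l x)"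
    have x': "x' \<in> M \<and> l x' = l x" unfolding x'_def by (rule someI[of _ x]) (simp add: x)
    then have "l (x' - x) = 0" using left_homD(2)[OF mod(1,2) M l, of x' x] x by simp
    then have "r (x' - x) = 0" using ker left_module.submodule_diff[OF mod(1) M, of x' x] x x' by blast
    then show ?thesis using left_homD(2)[OF mod(1,3) M r, of x' x] x x' by (simp add: f_def x'_def)
  qed
  show "left_hom scale\<^sub>1 (l ` M) scale\<^sub>2 (r ` M) f"
    unfolding left_hom_def
  proof (intro conjI ballI allI)
    show "f y \<in> r ` M" if "y \<in> l ` M" for y using that f by auto
    fix y z assume "y \<in> l ` M" "z \<in> l ` M"
    then obtain a b where ab: "y = l a" "z = l b" "a \<in> M" "b \<in> M" by blast
    then have "a + b \<in> M" "y + z = l (a + b)" using M l by (auto simp: submodule_def left_hom_def)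
    then show "f (y + z) = f y + f z" using ab f r by (simp add: left_hom_def)
  next
    fix s y assume "y \<in> l ` M"
    then obtain a where a: "y = l a" "a \<in> M" by blast
    then have "scale s a \<in> M" "scale\<^sub>1 s y = l (scale s a)" using M l by (auto simp: submodule_def left_hom_def)
    then show "f (scale\<^sub>1 s y) = scale\<^sub>2 s (f y)" using a f r by (simp add: left_hom_def)
  qed
qed

text \<open>The assignment of \<open>r x\<close> to \<open>l x\<close> is well defined by one half
  of \<open>ker\<close> and injective by the other, so \<open>pseudo_injective_unit\<close> applies
  to it.\<close>

lemma same_kernel_unit:
  assumes art: "left_artinian TYPE('r::{ring,monoid_mult})"
    and pinj: "left_pseudo_injective TYPE('r)"
    and M: "left_module scale" "submodule scale M"
    and l: "left_hom scale M (*) (UNIV :: 'r set) l" and r: "left_hom scale M (*) (UNIV :: 'r set) r"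
    and ker: "\<And>x. x \<in> M \<Longrightarrow> l x = 0 \<longleftrightarrow> r x = 0"
  obtains u where "u \<in> ring_units" "\<And>x. x \<in> M \<Longrightarrow> r x = l x * u"
proof -
  obtain f where f: "left_hom (*) (l ` M) (*) (r ` M) f" "\<And>x. x \<in> M \<Longrightarrow> f (l x) = r x"
    using hom_factor[OF M(1) left_module_mult left_module_mult M(2) l r] ker by blast
  have f': "left_hom (*) (l ` M) (*) UNIV f" using left_hom_mono[OF f(1) subset_refl subset_UNIV] .
  have ideal: "left_ideal (l ` M)" using left_homD(4)[OF M(1) left_module_mult M(2) l] .
  have "inj_on f (l ` M)"
    unfolding ideal_homD(3)[OF ideal f'] using f(2) ker by auto
  then obtain u where "u \<in> ring_units" "\<And>y. y \<in> l ` M \<Longrightarrow> f y = y * u"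
    using pseudo_injective_unit[OF art pinj ideal f'] by blast
  then show thesis using that[of u] f(2) by auto
qed

lemma hamming_weight_zeros: "hamming_weight n y + card {i\<in>{..<n}. y i = 0} = n"
proof -
  have "hamming_weight n y = card {i\<in>{..<n}. y i \<noteq> 0}"
    by (simp add: hamming_weight_def sum.If_cases Int_def conj_commute)
  moreover have "card ({i\<in>{..<n}. y i \<noteq> 0} \<union> {i\<in>{..<n}. y i = 0})
    = card {i\<in>{..<n}. y i \<noteq> 0} + card {i\<in>{..<n}. y i = 0}"
    by (rule card_Un_disjoint) auto
  moreover have "{i\<in>{..<n}. y i \<noteq> 0} \<union> {i\<in>{..<n}. y i = 0} = {..<n}" by auto
  ultimately show ?thesis by simp
qed

text \<open>A matched pair is removed: the counts of zeros stay equal because its two members vanish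
  at the same \<open>x\<close>. This is why the index sets are arbitrary finite sets instead of
  initial segments.\<close>

lemma (in faithful_socle_character) match_coordinates:
  fixes \<pi> :: "'i \<Rightarrow> 'm::ab_group_add \<Rightarrow> 'r" and \<rho> :: "'j \<Rightarrow> 'm \<Rightarrow> 'r"
  assumes art: "left_artinian TYPE('r)" and pinj: "left_pseudo_injective TYPE('r)"
    and M: "left_module scale" "submodule scale M"
    and "finite I" "finite J"
    and "\<And>i. i \<in> I \<Longrightarrow> left_hom scale M (*) UNIV (\<pi> i)"
    and "\<And>j. j \<in> J \<Longrightarrow> left_hom scale M (*) UNIV (\<rho> j)"
    and "\<And>x. x \<in> M \<Longrightarrow> card {i\<in>I. \<pi> i x = 0} = card {j\<in>J. \<rho> j x = 0}"
  shows "\<exists>\<sigma> u. bij_betw \<sigma> J I \<and> (\<forall>j\<in>J. u j \<in> ring_units \<and> (\<forall>x\<in>M. \<rho> j x = \<pi> (\<sigma> j) x * u j))"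
  using assms(5-)
proof (induction I arbitrary: J rule: finite_remove_induct)
  case empty
  have "0 \<in> M" using M(2) by (simp add: submodule_def)
  moreover have "\<rho> j 0 = 0" if "j \<in> J" for j
    using left_homD(1)[OF M(1) left_module_mult M(2) empty(3)[OF that]] .
  then have "{j\<in>J. \<rho> j 0 = 0} = J" by blast
  ultimately have "card J = 0" using empty(4)[of 0] by simp
  then have "J = {}" using empty(1) by simp
  then show ?case by (auto simp: bij_betw_def)
next
  case (remove I)
  obtain i j where ij: "i \<in> I" "j \<in> J" "\<And>x. x \<in> M \<Longrightarrow> \<pi> i x = 0 \<longleftrightarrow> \<rho> j x = 0"
    using common_kernel[OF remove.hyps(1) remove.prems(1) remove.hyps(2) M remove.prems(2-4)] by blast
  obtain v where v: "v \<in> ring_units" "\<And>x. x \<in> M \<Longrightarrow> \<rho> j x = \<pi> i x * v"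
    using same_kernel_unit[OF art pinj M remove.prems(2)[OF ij(1)] remove.prems(3)[OF ij(2)] ij(3)] by blast
  have "\<exists>\<sigma> u. bij_betw \<sigma> (J - {j}) (I - {i}) \<and>
    (\<forall>j\<in>J - {j}. u j \<in> ring_units \<and> (\<forall>x\<in>M. \<rho> j x = \<pi> (\<sigma> j) x * u j))"
  proof (rule remove.IH[OF ij(1)])
    fix x assume x: "x \<in> M"
    have "{i'\<in>I - {i}. \<pi> i' x = 0} = {i'\<in>I. \<pi> i' x = 0} - {i}"
      "{j'\<in>J - {j}. \<rho> j' x = 0} = {j'\<in>J. \<rho> j' x = 0} - {j}" by auto
    then show "card {i'\<in>I - {i}. \<pi> i' x = 0} = card {j'\<in>J - {j}. \<rho> j' x = 0}"
      using remove.prems(4)[OF x] ij(1,2) ij(3)[OF x] by (simp add: card_Diff_singleton_if)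
  qed (use remove.prems in auto)
  then obtain \<sigma> u where \<sigma>: "bij_betw \<sigma> (J - {j}) (I - {i})"
    and u: "\<forall>j\<in>J - {j}. u j \<in> ring_units \<and> (\<forall>x\<in>M. \<rho> j x = \<pi> (\<sigma> j) x * u j)" by blast
  have "bij_betw (\<sigma>(j := i)) (J - {j}) (I - {i})" 
    using \<sigma> by (rule bij_betw_cong[THEN iffD1, rotated]) auto
  then have "bij_betw (\<sigma>(j := i)) (insert j (J - {j})) (insert i (I - {i}))"
    using bij_betw_combine[of "\<sigma>(j := i)" "{j}" "{i}" "J - {j}" "I - {i}"] by (simp add: bij_betw_def)
  moreover have "insert j (J - {j}) = J" "insert i (I - {i}) = I" using ij by auto
  ultimately have "bij_betw (\<sigma>(j := i)) J I" by simp
  moreover have "(u(j := v)) k \<in> ring_units \<and> (\<forall>x\<in>M. \<rho> k x = \<pi> ((\<sigma>(j := i)) k) x * (u(j := v)) k)"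
    if "k \<in> J" for k
    using that u v by auto
  ultimately show ?case by blast
qed

lemma (in faithful_socle_character) pseudo_injective_imp_MacWilliams:
  assumes art: "left_artinian TYPE('r)" and pinj: "left_pseudo_injective TYPE('r)"
  shows "left_MacWilliams TYPE('r)"
  unfolding left_MacWilliams_def
proof (intro allI impI)
  fix n :: nat and M N :: "(nat \<Rightarrow> 'r) set" and \<phi>
  assume asm: "submodule vec_scale M \<and> M \<subseteq> vec_space n \<and>
    submodule vec_scale N \<and> N \<subseteq> vec_space n \<and>
    left_hom vec_scale M vec_scale N \<phi> \<and>
    (\<forall>x\<in>M. hamming_weight n (\<phi> x) = hamming_weight n x)"
  have "\<exists>\<sigma> u. bij_betw \<sigma> {..<n} {..<n} \<and>
    (\<forall>j\<in>{..<n}. u j \<in> ring_units \<and> (\<forall>x\<in>M. \<phi> x j = x (\<sigma> j) * u j))"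
  proof (rule match_coordinates[OF art pinj left_module_vec_scale, of M "{..<n}" "{..<n}" "\<lambda>i x. x i" "\<lambda>j x. \<phi> x j"])
    fix x assume x: "x \<in> M"
    show "card {i\<in>{..<n}. x i = 0} = card {j\<in>{..<n}. \<phi> x j = 0}"
      using hamming_weight_zeros[of n x] hamming_weight_zeros[of n "\<phi> x"] asm x by auto
  qed (use asm in \<open>auto simp: left_hom_def vec_scale_def\<close>)
  then obtain \<sigma> u where \<sigma>: "bij_betw \<sigma> {..<n} {..<n}"
    and u: "\<forall>j\<in>{..<n}. u j \<in> ring_units \<and> (\<forall>x\<in>M. \<phi> x j = x (\<sigma> j) * u j)" by blast
  define \<sigma>' where "\<sigma>' j = (if j < n then \<sigma> j else j)" for j
  have "bij_betw \<sigma>' {..<n} {..<n}"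
    using \<sigma> by (rule bij_betw_cong[THEN iffD1, rotated]) (simp add: \<sigma>'_def)
  then have "\<sigma>' permutes {..<n}" by (rule bij_imp_permutes) (simp add: \<sigma>'_def)
  moreover have "\<phi> x = monomial_map n \<sigma>' u x" if x: "x \<in> M" for x
  proof
    fix i show "\<phi> x i = monomial_map n \<sigma>' u x i"
    proof (cases "i < n")
      case False
      have "\<phi> x \<in> vec_space n" using asm x by (auto simp: left_hom_def)
      then show ?thesis using False by (simp add: vec_space_def monomial_map_def)
    qed (use u x in \<open>auto simp: monomial_map_def \<sigma>'_def\<close>)
  qed
  ultimately show "\<exists>\<sigma> u. \<sigma> permutes {..<n} \<and> (\<forall>i<n. u i \<in> ring_units) \<and>
    (\<forall>x\<in>M. \<phi> x = monomial_map n \<sigma> u x)"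
    using u by (intro exI[of _ \<sigma>'] exI[of _ u]) auto
qed

lemma principal_socle_imp_faithful_character:
  assumes art: "left_artinian TYPE('r::{ring,monoid_mult})"
    and principal: "(finitary_left_socle :: 'r set) = range (\<lambda>r. r * a)"
  obtains \<chi> where "faithful_socle_character (finitary_left_socle :: 'r set) \<chi>"
proof -
  let ?\<S> = "{I :: 'r set. minimal_left_ideal I \<and> finite I}"
  note socle = finitary_left_socle_finite_sum[OF art]
  have min: "?\<S> \<subseteq> Collect minimal_left_ideal" and fin: "\<And>S. S \<in> ?\<S> \<Longrightarrow> finite S" by blast+
  have ideal: "left_ideal (finitary_left_socle :: 'r set)" using finite_sum_left_ideal[OF socle(1) min] .
  obtain \<chi> where \<chi>: "\<chi> \<in> characters (finitary_left_socle :: 'r set)"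
    "\<And>K. left_ideal K \<Longrightarrow> K \<subseteq> finitary_left_socle \<Longrightarrow> K \<noteq> {0} \<Longrightarrow> \<exists>x\<in>K. \<chi> x \<noteq> 1"
    using faithful_character[OF socle(1) min fin principal] by blast
  have "faithful_socle_character (finitary_left_socle :: 'r set) \<chi>"
  proof
    show "finite (finitary_left_socle :: 'r set)" using finite_finite_sum[OF socle(1) fin] .
    fix K :: "'r set" assume K: "left_ideal K" "K \<noteq> {0}" "finite K"
    obtain S where S: "minimal_left_ideal S" "S \<subseteq> K" using contains_minimal_left_ideal[OF art K(1,2)] .
    have sub: "S \<subseteq> finitary_left_socle" using socle(2)[OF S(1) finite_subset[OF S(2) K(3)]] .
    then obtain x where "x \<in> S" "\<chi> x \<noteq> 1" using \<chi>(2)[OF minimal_left_idealD(1)[OF S(1)] sub minimal_left_idealD(2)[OF S(1)]] by blast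
    then show "\<exists>a\<in>K. a \<in> finitary_left_socle \<and> \<chi> a \<noteq> 1" using S(2) sub by blast
  qed (fact ideal, fact \<chi>(1))
  then show thesis by (rule that)
qed

section \<open>Necessity\<close>

text \<open>The equations are triangular: for a minimal member \<open>U\<close> of the family,
  \<open>\<eta> U\<close> occurs only in the equation of \<open>U\<close> itself, so it can be
  chosen after all the others are solved.\<close>

lemma moebius_weights:
  fixes t :: "'a set \<Rightarrow> int"
  assumes "finite \<W>"
  obtains \<eta> where "\<And>V. V \<in> \<W> \<Longrightarrow> (\<Sum>W | W \<in> \<W> \<and> V \<subseteq> W. \<eta> W) = t V"
proof -
  have "\<exists>\<eta>. \<forall>V\<in>\<W>. (\<Sum>W | W \<in> \<W> \<and> V \<subseteq> W. \<eta> W) = t V"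
    using assms
  proof (induction \<W> rule: finite_psubset_induct)
    case (psubset \<W>)
    show ?case
    proof (cases "\<W> = {}")
      case False
      have "\<exists>U\<in>\<W>. \<forall>W\<in>\<W>. W \<subseteq> U \<longrightarrow> U = W"
        using psubset.hyps False by (rule finite_has_minimal)
      then obtain U where U: "U \<in> \<W>" "\<forall>W\<in>\<W>. W \<subseteq> U \<longrightarrow> U = W" by (rule bexE)
      then have "\<W> - {U} \<subset> \<W>" by blast
      from psubset.IH[OF this] obtain \<eta> where
        \<eta>: "\<forall>V\<in>\<W> - {U}. (\<Sum>W | W \<in> \<W> - {U} \<and> V \<subseteq> W. \<eta> W) = t V" ..
      let ?r = "\<Sum>W | W \<in> \<W> - {U} \<and> U \<subseteq> W. \<eta> W"
      let ?\<eta> = "\<eta>(U := t U - ?r)"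
      have "(\<Sum>W | W \<in> \<W> \<and> V \<subseteq> W. ?\<eta> W) = t V" if V: "V \<in> \<W>" for V
      proof (cases "V = U")
        case True
        have set: "{W. W \<in> \<W> \<and> U \<subseteq> W} = insert U {W. W \<in> \<W> - {U} \<and> U \<subseteq> W}" using U(1) by blast
        have "(\<Sum>W | W \<in> \<W> - {U} \<and> U \<subseteq> W. ?\<eta> W) = ?r" by (rule sum.cong) auto
        then show ?thesis unfolding True set using psubset.hyps by (subst sum.insert) auto
      next
        case False
        then have set: "{W. W \<in> \<W> \<and> V \<subseteq> W} = {W. W \<in> \<W> - {U} \<and> V \<subseteq> W}" using U(2) V by blast
        have "(\<Sum>W | W \<in> \<W> - {U} \<and> V \<subseteq> W. ?\<eta> W) = (\<Sum>W | W \<in> \<W> - {U} \<and> V \<subseteq> W. \<eta> W)"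
          by (rule sum.cong) auto
        also have "\<dots> = t V" using \<eta> V False by simp
        finally show ?thesis unfolding set .
      qed
      then show ?thesis by blast
    qed simp
  qed
  with that show thesis by blast
qed

lemma list_with_counts:
  assumes "finite X"
  obtains ws where "set ws \<subseteq> X" "\<And>x. x \<in> X \<Longrightarrow> count_list ws x = c x"
proof -
  have "\<exists>ws. set ws \<subseteq> X \<and> (\<forall>x\<in>X. count_list ws x = c x)"
    using assms
  proof (induction X rule: finite_induct)
    case (insert y X)
    then obtain ws where ws: "set ws \<subseteq> X" "\<forall>x\<in>X. count_list ws x = c x" by blast
    have "count_list (replicate n y) x = (if x = y then n else 0)" for n x by (induction n) auto
    moreover have "count_list ws y = 0" using ws(1) insert.hyps by (intro count_notin) blast
    ultimately show ?case
      using ws insert.hyps by (intro exI[of _ "replicate (c y) y @ ws"]) (auto simp: set_replicate_conv_if)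
  qed simp
  with that show thesis by blast
qed

lemma card_nth_eq_sum_counts:
  assumes "set ws \<subseteq> X" "finite X"
  shows "card {i. i < length ws \<and> P (ws ! i)} = (\<Sum>x | x \<in> X \<and> P x. count_list ws x)"
proof -
  have count: "count_list (filter P ws) x = count_list ws x" if "P x" for x
    using that by (induction ws) auto
  have "card {i. i < length ws \<and> P (ws ! i)} = length (filter P ws)" by (simp add: length_filter_conv_card)
  also have "\<dots> = (\<Sum>x | x \<in> X \<and> P x. count_list (filter P ws) x)"
    using assms by (intro sum_count_set[symmetric]) auto
  also have "\<dots> = (\<Sum>x | x \<in> X \<and> P x. count_list ws x)" using count by (intro sum.cong) auto
  finally show ?thesis .
qed

text \<open>Semisimplicity of \<open>A\<close> provides a complement of \<open>W\<close>; the
  projection onto it along \<open>W\<close> has kernel \<open>W\<close>.\<close>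

lemma hom_with_kernel:
  assumes "finite_sum \<S> A" and min: "\<S> \<subseteq> Collect minimal_left_ideal"
    and W: "left_ideal W" "W \<subseteq> A"
  obtains h where "left_hom (*) A (*) A h" "\<And>x. x \<in> A \<Longrightarrow> h x = 0 \<longleftrightarrow> x \<in> W"
proof -
  obtain K where K: "finite_sum \<S> K" "left_ideal K" "K \<subseteq> A" "W \<inter> K = {0}" "A \<subseteq> W + K"
    by (rule complement_of_finite_sum[OF assms(1) min W(1)])
  have "A = W + K"
    using K(5) plus_subset[OF finite_sum_left_ideal[OF assms(1) min] W(2) K(3)] by blast
  obtain p q where pq: "left_hom (*) (W + K) (*) W p" "left_hom (*) (W + K) (*) K q"
    "\<And>a b. a \<in> W \<Longrightarrow> b \<in> K \<Longrightarrow> p (a + b) = a" "\<And>a b. a \<in> W \<Longrightarrow> b \<in> K \<Longrightarrow> q (a + b) = b"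
    using direct_sum_projections[OF W(1) K(2,4)] by metis
  show thesis
  proof (rule that[of q])
    show "left_hom (*) A (*) A q" using left_hom_mono[OF pq(2) _ K(3)] \<open>A = W + K\<close> by blast
    fix x assume "x \<in> A"
    then have "x \<in> W + K" using K(5) by blast
    then obtain a b where x: "x = a + b" "a \<in> W" "b \<in> K" by (auto elim: set_plus_elim)
    have "b = 0" if "x \<in> W"
    proof -
      have "b = x - a" using x(1) by simp
      then have "b \<in> W \<inter> K" using left_idealD(5)[OF W(1) that x(2)] x(3) by simp
      then show ?thesis using K(4) by blast
    qed
    then show "q x = 0 \<longleftrightarrow> x \<in> W" using x pq(4) by auto
  qed
qed

lemma left_MacWilliamsD:
  assumes mac: "left_MacWilliams TYPE('r::{ring,monoid_mult})" and n: "n \<ge> 1"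
    and "submodule vec_scale (M :: (nat \<Rightarrow> 'r) set)" "M \<subseteq> vec_space n"
    and "submodule vec_scale N" "N \<subseteq> vec_space n"
    and "left_hom vec_scale M vec_scale N \<phi>"
    and "\<And>x. x \<in> M \<Longrightarrow> hamming_weight n (\<phi> x) = hamming_weight n x"
  obtains \<sigma> u where "\<sigma> permutes {..<n}" "\<And>x. x \<in> M \<Longrightarrow> \<phi> x = monomial_map n \<sigma> u x"
proof -
  have "\<exists>\<sigma> u. \<sigma> permutes {..<n} \<and> (\<forall>i<n. u i \<in> ring_units) \<and> (\<forall>x\<in>M. \<phi> x = monomial_map n \<sigma> u x)"
    by (rule mac[unfolded left_MacWilliams_def, rule_format, OF n, of M N]) (use assms(3-) in simp)
  with that show thesis by blast
qed

text \<open>If the finite semisimple left ideal \<open>A\<close> is not principal, weight its submodules \<open>W\<close> by Moebius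
  inversion so that the submodules above any \<open>V \<noteq> A\<close> have total weight \<open>0\<close>, and \<open>A\<close> has weight \<open>1\<close>.
  Homomorphisms with kernel \<open>W\<close>, repeated according to the positive and to the negative weights, are
  the coordinates of two codes: the weights of corresponding words agree because no element generates
  \<open>A\<close>, but only the first code has a coordinate that vanishes identically.\<close>

lemma MacWilliams_imp_principal:
  assumes mac: "left_MacWilliams TYPE('r::{ring,monoid_mult})"
    and A: "finite_sum \<S> (A :: 'r set)" and min: "\<S> \<subseteq> Collect minimal_left_ideal" and fin: "finite A"
  obtains a where "A = range (\<lambda>r. r * a)"
proof (rule ccontr)
  assume not_thesis: "\<not> thesis"
  have not_principal: "A \<noteq> range (\<lambda>r. r * a)" for a
    using that[of a] not_thesis by blast
  have ideal: "left_ideal A" using finite_sum_left_ideal[OF A min] .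
  define \<W> where "\<W> = {W. left_ideal W \<and> W \<subseteq> A}"
  have fin_\<W>: "finite \<W>" by (rule finite_subset[of _ "Pow A"]) (use fin in \<open>auto simp: \<W>_def\<close>)
  obtain \<eta> where \<eta>: "\<And>V. V \<in> \<W> \<Longrightarrow> (\<Sum>W | W \<in> \<W> \<and> V \<subseteq> W. \<eta> W) = (if V = A then 1 else 0 :: int)"
    using moebius_weights[OF fin_\<W>, of "\<lambda>V. if V = A then 1 else 0"] by blast
  obtain ws where ws: "set ws \<subseteq> \<W>" "\<And>W. W \<in> \<W> \<Longrightarrow> count_list ws W = nat (\<eta> W)"
    using list_with_counts[OF fin_\<W>, of "\<lambda>W. nat (\<eta> W)"] by blast
  obtain vs where vs: "set vs \<subseteq> \<W>" "\<And>W. W \<in> \<W> \<Longrightarrow> count_list vs W = nat (- \<eta> W)"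
    using list_with_counts[OF fin_\<W>, of "\<lambda>W. nat (- \<eta> W)"] by blast
  have A_\<W>: "A \<in> \<W>" using ideal by (simp add: \<W>_def)
  have "{W. W \<in> \<W> \<and> A \<subseteq> W} = {A}" using A_\<W> by (auto simp: \<W>_def)
  then have "\<eta> A = 1" using \<eta>[OF A_\<W>] by simp
  then have "count_list ws A = 1" "count_list vs A = 0" using ws(2) vs(2) A_\<W> by simp_all
  then have A_ws: "A \<in> set ws" and A_vs: "A \<notin> set vs"
    by (metis count_notin zero_neq_one) (use \<open>count_list vs A = 0\<close> in \<open>simp add: count_list_0_iff\<close>)
  have balanced: "card {i. i < length ws \<and> x \<in> ws ! i} = card {i. i < length vs \<and> x \<in> vs ! i}"
    if x: "x \<in> A" for x
  proof -
    \<comment> \<open>The coordinate with kernel \<open>W\<close> vanishes at \<open>x\<close> iff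
      \<open>W\<close> contains the left ideal \<open>R x\<close>, and by
      \<open>not_principal\<close> this left ideal is not \<open>A\<close>, so the weights above it
      add up to 0.\<close>
    let ?Rx = "range (\<lambda>r. r * x)"
    have Rx: "?Rx \<in> \<W>"
      using left_ideal_image_mult[OF left_ideal_UNIV] left_idealD(3)[OF ideal x] by (auto simp: \<W>_def)
    have "1 * x \<in> ?Rx" by blast
    then have "x \<in> ?Rx" by simp
    then have "?Rx \<subseteq> W \<longleftrightarrow> x \<in> W" if "W \<in> \<W>" for W
      using left_idealD(3)[of W x] that unfolding \<W>_def by blast
    then have "{W. W \<in> \<W> \<and> ?Rx \<subseteq> W} = {W. W \<in> \<W> \<and> x \<in> W}" by blast
    then have "(\<Sum>W | W \<in> \<W> \<and> x \<in> W. \<eta> W) = 0" using \<eta>[OF Rx] not_principal[of x] by simp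
    moreover have "(\<Sum>W | W \<in> \<W> \<and> x \<in> W. \<eta> W)
      = (\<Sum>W | W \<in> \<W> \<and> x \<in> W. int (count_list ws W) - int (count_list vs W))"
      using ws(2) vs(2) by (intro sum.cong) auto
    ultimately have "int (\<Sum>W | W \<in> \<W> \<and> x \<in> W. count_list ws W) = int (\<Sum>W | W \<in> \<W> \<and> x \<in> W. count_list vs W)"
      by (simp add: sum_subtractf)
    then have "(\<Sum>W | W \<in> \<W> \<and> x \<in> W. count_list ws W) = (\<Sum>W | W \<in> \<W> \<and> x \<in> W. count_list vs W)"
      by (simp only: of_nat_eq_iff)
    then show ?thesis
      using card_nth_eq_sum_counts[OF ws(1) fin_\<W>, of "\<lambda>W. x \<in> W"]
        card_nth_eq_sum_counts[OF vs(1) fin_\<W>, of "\<lambda>W. x \<in> W"] by simp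
  qed
  define n where "n = length ws"
  have nth_\<W>: "i < length ws \<Longrightarrow> ws ! i \<in> \<W>" "i < length vs \<Longrightarrow> vs ! i \<in> \<W>" for i
    using ws(1) vs(1) nth_mem by blast+
  \<comment> \<open>All kernels contain 0, so \<open>balanced\<close> at 0 shows that both lists
    have the same length.\<close>
  have zero_nth: "i < length ws \<Longrightarrow> 0 \<in> ws ! i" "i < length vs \<Longrightarrow> 0 \<in> vs ! i" for i
    using nth_\<W>[of i] left_idealD(1) unfolding \<W>_def by blast+
  then have "{i. i < length ws \<and> 0 \<in> ws ! i} = {..<length ws}"
    "{i. i < length vs \<and> 0 \<in> vs ! i} = {..<length vs}" by auto
  then have n_vs: "length vs = n" using balanced[OF left_idealD(1)[OF ideal]] by (simp add: n_def)
  have "\<forall>W. \<exists>h. W \<in> \<W> \<longrightarrow> left_hom (*) A (*) A h \<and> (\<forall>x\<in>A. h x = 0 \<longleftrightarrow> x \<in> W)"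
  proof
    fix W show "\<exists>h. W \<in> \<W> \<longrightarrow> left_hom (*) A (*) A h \<and> (\<forall>x\<in>A. h x = 0 \<longleftrightarrow> x \<in> W)"
    proof (cases "W \<in> \<W>")
      case True
      then show ?thesis using hom_with_kernel[OF A min, of W] unfolding \<W>_def by (metis mem_Collect_eq)
    qed simp
  qed
  then obtain h where h: "\<And>W. W \<in> \<W> \<Longrightarrow> left_hom (*) A (*) A (h W)"
    "\<And>W x. W \<in> \<W> \<Longrightarrow> x \<in> A \<Longrightarrow> h W x = 0 \<longleftrightarrow> x \<in> W" by metis
  define \<Phi> where "\<Phi> L x = (\<lambda>i. if i < n then h (L ! i) x else 0)" for L x
  have \<Phi>_hom: "left_hom (*) A vec_scale (vec_space n) (\<Phi> L)" if "\<And>i. i < n \<Longrightarrow> L ! i \<in> \<W>" for L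
    using h(1)[OF that] by (auto simp: left_hom_def \<Phi>_def vec_scale_def vec_space_def fun_eq_iff)
  have homs: "left_hom (*) A vec_scale (vec_space n) (\<Phi> ws)" "left_hom (*) A vec_scale (vec_space n) (\<Phi> vs)"
    using \<Phi>_hom nth_\<W> n_vs n_def by auto
  have zeros: "{i\<in>{..<n}. \<Phi> ws x i = 0} = {i. i < length ws \<and> x \<in> ws ! i}"
    "{i\<in>{..<n}. \<Phi> vs x i = 0} = {i. i < length vs \<and> x \<in> vs ! i}" if "x \<in> A" for x
    using h(2) nth_\<W> n_vs that by (auto simp: \<Phi>_def n_def)
  have weight: "hamming_weight n (\<Phi> vs x) = hamming_weight n (\<Phi> ws x)" if "x \<in> A" for x
    using hamming_weight_zeros[of n "\<Phi> ws x"] hamming_weight_zeros[of n "\<Phi> vs x"] balanced[OF that] zeros[OF that]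
    by simp
  \<comment> \<open>A word of weight 0 is zero, so the first word determines the second and the map
    between the codes is well defined.\<close>
  have ker: "\<Phi> vs x = 0" if "x \<in> A" "\<Phi> ws x = 0" for x
  proof -
    have "hamming_weight n (\<Phi> vs x) = 0" using weight[OF that(1)] that(2) by (simp add: hamming_weight_def)
    then show ?thesis by (auto simp: hamming_weight_def \<Phi>_def fun_eq_iff split: if_splits)
  qed
  obtain \<phi> where \<phi>: "left_hom vec_scale (\<Phi> ws ` A) vec_scale (\<Phi> vs ` A) \<phi>"
    "\<And>x. x \<in> A \<Longrightarrow> \<phi> (\<Phi> ws x) = \<Phi> vs x"
    using hom_factor[OF left_module_mult left_module_vec_scale left_module_vec_scale ideal homs] ker by blast
  obtain i0 where i0: "i0 < n" "ws ! i0 = A" using A_ws by (auto simp: in_set_conv_nth n_def)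
  have "submodule vec_scale (\<Phi> ws ` A)" "submodule vec_scale (\<Phi> vs ` A)"
    using left_homD(4)[OF left_module_mult left_module_vec_scale ideal] homs by blast+
  moreover have "\<Phi> ws ` A \<subseteq> vec_space n" "\<Phi> vs ` A \<subseteq> vec_space n"
    using homs by (auto simp: left_hom_def)
  moreover have "hamming_weight n (\<phi> v) = hamming_weight n v" if "v \<in> \<Phi> ws ` A" for v
    using that \<phi>(2) weight by auto
  moreover have "1 \<le> n" using i0(1) by simp
  ultimately obtain \<sigma> u where \<sigma>: "\<sigma> permutes {..<n}"
    and mono: "\<And>v. v \<in> \<Phi> ws ` A \<Longrightarrow> \<phi> v = monomial_map n \<sigma> u v"
    using left_MacWilliamsD[OF mac, of n "\<Phi> ws ` A" "\<Phi> vs ` A" \<phi>] \<phi>(1) by metis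
  have "i0 \<in> \<sigma> ` {..<n}" using permutes_image[OF \<sigma>] i0(1) by simp
  then obtain i where i: "i < n" "\<sigma> i = i0" by auto
  \<comment> \<open>Position \<open>i\<close> of the second code receives the vanishing coordinate
    \<open>i0\<close> of the first, so its kernel is all of \<open>A\<close>, which is not in
    \<open>vs\<close>.\<close>
  have "x \<in> vs ! i" if x: "x \<in> A" for x
  proof -
    have "\<Phi> vs x i = \<Phi> ws x (\<sigma> i) * u i"
      using mono[OF imageI[OF x]] i(1) unfolding \<phi>(2)[OF x] by (simp add: monomial_map_def)
    also have "\<Phi> ws x (\<sigma> i) = 0" using h(2)[OF A_\<W> x] x i0 by (simp add: i(2) \<Phi>_def)
    finally have "h (vs ! i) x = 0" using i(1) by (simp add: \<Phi>_def)
    then show ?thesis using h(2)[OF nth_\<W>(2) x] i(1) n_vs by simp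
  qed
  moreover have "vs ! i \<subseteq> A" using nth_\<W>(2)[of i] i(1) n_vs by (simp add: \<W>_def)
  ultimately have "vs ! i = A" by blast
  then show False using A_vs i(1) n_vs nth_mem by metis
qed

text \<open>Codes of length 1: there the weight only tells zero from nonzero, so an injective
  homomorphism preserves it, and the only permutation is the identity.\<close>

lemma MacWilliams_imp_pseudo_injective:
  assumes mac: "left_MacWilliams TYPE('r::{ring,monoid_mult})"
  shows "left_pseudo_injective TYPE('r)"
  unfolding left_pseudo_injective_def
proof (intro allI impI)
  fix I :: "'r set" and f
  assume "left_ideal I \<and> left_hom (*) I (*) UNIV f \<and> inj_on f I"
  then have I: "left_ideal I" and f: "left_hom (*) I (*) UNIV f" "inj_on f I" by auto
  note fD = ideal_homD[OF I f(1)]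
  define e :: "'r \<Rightarrow> nat \<Rightarrow> 'r" where "e x i = (if i = 0 then x else 0)" for x i
  have e: "left_hom (*) X vec_scale (vec_space 1) e" for X :: "'r set"
    by (auto simp: left_hom_def e_def vec_scale_def vec_space_def fun_eq_iff)
  have e0: "e x 0 = x" for x by (simp add: e_def)
  define \<phi> where "\<phi> v = e (f (v 0))" for v :: "nat \<Rightarrow> 'r"
  have "left_hom vec_scale (e ` I) vec_scale (vec_space 1) \<phi>"
    using f(1) by (auto simp: left_hom_def \<phi>_def e_def vec_scale_def vec_space_def fun_eq_iff)
  moreover have "submodule vec_scale (e ` I)" using left_homD(4)[OF left_module_mult left_module_vec_scale I e] .
  moreover have "e ` I \<subseteq> vec_space 1" using e[of I] by (auto simp: left_hom_def)
  moreover have "hamming_weight 1 (\<phi> v) = hamming_weight 1 v" if "v \<in> e ` I" for v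
    using that fD(1,3) f(2) by (auto simp: hamming_weight_def \<phi>_def e0)
  ultimately obtain \<sigma> u where \<sigma>: "\<sigma> permutes {..<1}"
    and u: "\<And>v. v \<in> e ` I \<Longrightarrow> \<phi> v = monomial_map 1 \<sigma> u v"
    using left_MacWilliamsD[OF mac order_refl, of "e ` I" "vec_space 1" \<phi>] submodule_vec_space[of 1] by blast
  have "f x = x * u 0" if x: "x \<in> I" for x
  proof -
    have "\<sigma> 0 = 0" using permutes_in_image[OF \<sigma>, of 0] by simp
    then have "monomial_map 1 \<sigma> u (e x) 0 = x * u 0" by (simp add: monomial_map_def e0)
    moreover have "\<phi> (e x) 0 = f x" by (simp add: \<phi>_def e0)
    ultimately show ?thesis using u x by (metis image_eqI)
  qed
  then show "\<exists>c. \<forall>x\<in>I. f x = x * c" by blast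
qed

theorem theorem4p7:
  assumes "left_artinian TYPE('r::{ring,monoid_mult})"
  shows "left_MacWilliams TYPE('r) \<longleftrightarrow>
    left_pseudo_injective TYPE('r) \<and>
    embeds (*) (finitary_left_socle :: 'r set) rad_quot_scale (UNIV :: 'r rad_quot set)"
proof -
  let ?\<S> = "{I :: 'r set. minimal_left_ideal I \<and> finite I}"
  let ?A = "finitary_left_socle :: 'r set"
  have socle: "finite_sum ?\<S> ?A" by (rule finitary_left_socle_finite_sum(1)[OF assms])
  have min: "?\<S> \<subseteq> Collect minimal_left_ideal" by blast
  have fin: "finite ?A" using finite_finite_sum[OF socle] by blast
  show ?thesis
  proof
    assume mac: "left_MacWilliams TYPE('r)"
    obtain a where a: "?A = range (\<lambda>r. r * a)"
      using MacWilliams_imp_principal[OF mac socle min fin] .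
    have "1 * a \<in> range (\<lambda>r. r * a)" by blast
    then have "a \<in> ?A" using a by simp
    then have "embeds (*) ?A rad_quot_scale (UNIV :: 'r rad_quot set)"
      using principal_imp_embeds[OF assms] radical_annihilates_finite_sum[OF socle min] unfolding a by blast
    then show "left_pseudo_injective TYPE('r) \<and> embeds (*) ?A rad_quot_scale (UNIV :: 'r rad_quot set)"
      using MacWilliams_imp_pseudo_injective[OF mac] by blast
  next
    assume asm: "left_pseudo_injective TYPE('r) \<and> embeds (*) ?A rad_quot_scale (UNIV :: 'r rad_quot set)"
    obtain a where "?A = range (\<lambda>r. r * a)"
      using embeds_imp_principal[OF assms finite_sum_left_ideal[OF socle min]] asm by blast
    then obtain \<chi> where "faithful_socle_character ?A \<chi>"
      by (rule principal_socle_imp_faithful_character[OF assms])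
    then show "left_MacWilliams TYPE('r)"
      using faithful_socle_character.pseudo_injective_imp_MacWilliams[OF _ assms] asm by blast
  qed
qed

end
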